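(* Let $\alpha\in\mathbb{C}$, $\mu\in(-1/2,\infty)\setminus\{0\}$, $\rho\in(0,1)$, $x\in[-1,1]$, and let $R=\sqrt{1+\rho^2-2\rho x}$. Then $$\frac{(1-x^2)^{1/4-\mu/2}}{R^{1/2+\alpha-\mu}}\,\mathrm{P}_{\mu-\alpha-1/2}^{1/2-\mu}\!\left(\frac{1-\rho x}{R}\right)=\frac{(\rho/2)^{\mu-1/2}}{\Gamma(\mu+\frac12)}\sum_{n=0}^\infty\frac{(\alpha)_n}{(2\mu)_n}\,\rho^n\,C_n^\mu(x).$$
   Context: $(z)_n=\prod_{i=1}^n(z+i-1)$ is the Pochhammer symbol. ${}_2F_1(a,b;c;z)=\sum_{n\ge0}\frac{(a)_n(b)_n}{(c)_n}\frac{z^n}{n!}$ is the Gauss hypergeometric function, analytically continued to $\mathbb{C}\setminus[1,\infty)$. The Gegenbauer polynomials are $C_n^\mu(z)=\frac{(2\mu)_n}{n!}\,{}_2F_1(-n,n+2\mu;\mu+\frac12;\frac{1-z}{2})$. The Ferrers function of the first kind on $(-1,1)$ is $\mathrm{P}_\nu^\mu(x)=\frac{1}{\Gamma(1-\mu)}\left(\frac{1+x}{1-x}\right)^{\mu/2}{}_2F_1(-\nu,\nu+1;1-\mu;\frac{1-x}{2})$. At $x=\pm1$ (where $(1-\rho x)/R=1$) the left-hand side is understood as its limit as $x\to\pm1$ from within $(-1,1)$. *)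

theory Defs
  imports "HOL-Complex_Analysis.Complex_Analysis"
begin

definition hyp2f1_series :: "complex \<Rightarrow> complex \<Rightarrow> complex \<Rightarrow> complex \<Rightarrow> complex" where
  "hyp2f1_series a b c z =
     (\<Sum>n. pochhammer a n * pochhammer b n / pochhammer c n * z ^ n / fact n)"

text \<open>
  The Gauss hypergeometric function, for \<open>c\<close> not a non-positive integer. Off the cut
  \<open>[1, \<infinity>)\<close> it is the analytic continuation of the series; this is unique since the slit plane
  is connected. In the open unit disc the continuation is the series itself. On the cut, where
  there is no continuation to speak of, the series is kept. It terminates if \<open>a\<close> or \<open>b\<close> is a
  non-positive integer, so the polynomial cases have their usual values on the whole plane.
\<close>
definition hyp2f1 :: "complex \<Rightarrow> complex \<Rightarrow> complex \<Rightarrow> complex \<Rightarrow> complex" where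
  "hyp2f1 a b c z =
     (if norm z < 1 \<or> z \<in> complex_of_real ` {1..} then hyp2f1_series a b c z
      else (THE w. \<exists>f. f holomorphic_on (- complex_of_real ` {1..}) \<and>
                      (\<forall>u. norm u < 1 \<longrightarrow> f u = hyp2f1_series a b c u) \<and> w = f z))"

definition gegenbauer :: "nat \<Rightarrow> complex \<Rightarrow> complex \<Rightarrow> complex" where
  "gegenbauer n \<mu> z =
     pochhammer (2 * \<mu>) n / fact n * hyp2f1 (- of_nat n) (of_nat n + 2 * \<mu>) (\<mu> + 1/2) ((1 - z) / 2)"

text \<open>The Ferrers function of the first kind, of degree \<open>\<nu>\<close> and order \<open>\<mu>\<close>, for \<open>-1 < x < 1\<close>.\<close>
definition ferrers_P :: "complex \<Rightarrow> complex \<Rightarrow> real \<Rightarrow> complex" where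
  "ferrers_P \<nu> \<mu> x =
     1 / Gamma (1 - \<mu>) * complex_of_real ((1 + x) / (1 - x)) powr (\<mu> / 2) *
       hyp2f1 (- \<nu>) (\<nu> + 1) (1 - \<mu>) (complex_of_real ((1 - x) / 2))"

end

theory Submission
  imports Defs
begin

text \<open>
  Put \<open>c = \<mu> + 1/2\<close>, so that \<open>2 * \<mu> = 2 * c - 1\<close>, and let \<open>p\<^sub>n(x) = F(-n, n + 2\<mu>; c; (1 - x)/2)\<close>
  be the Gegenbauer polynomial without its factor \<open>(2\<mu>)\<^sub>n / n!\<close>. The series in the theorem is then
  \<open>\<Sum> (\<alpha>)\<^sub>n / n! p\<^sub>n(x) \<rho>\<^sup>n\<close>. With \<open>y = (1 - \<rho> x) / R\<close>, the left-hand side is, up to the constant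
  \<open>(\<rho>/2)\<^bsup>\<mu> - 1/2\<^esup> / \<Gamma>(c)\<close>, equal to \<open>R\<^bsup>-\<alpha>\<^esup> F(\<alpha>, 2\<mu> - \<alpha>; c; (1 - y)/2)\<close>: Euler's transformation turns
  the parameters of the Ferrers function into these, and the elementary factors collapse because
  \<open>(1 - y\<^sup>2) R\<^sup>2 = \<rho>\<^sup>2 (1 - x\<^sup>2)\<close>. So the claim is the generating function
  \<open>\<Sum> (\<alpha>)\<^sub>n / n! p\<^sub>n(x) \<rho>\<^sup>n = R\<^bsup>-\<alpha>\<^esup> F(\<alpha>, 2\<mu> - \<alpha>; c; (1 - y)/2)\<close>.

  Everything rests on one quadratic transformation (\<open>hyp_fps_quadratic\<close>),
  \<open>F(\<alpha>, 2c - 1 - \<alpha>; c; (1 - y)/2) = y\<^bsup>-\<alpha>\<^esup> F(\<alpha>/2, (\<alpha> + 1)/2; c; 1 - 1/y\<^sup>2)\<close>, used twice.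
  For \<open>\<alpha> = -n\<close> it terminates and gives the Laplace form
  \<open>p\<^sub>n(x) = \<Sum>\<^sub>k n! / (4\<^sup>k (c)\<^sub>k k! (n - 2k)!) (x\<^sup>2 - 1)\<^sup>k x\<^bsup>n - 2k\<^esup>\<close> (\<open>eval_hyp_fps_terminating\<close>).
  This form has the shape of a Cauchy product, and so \<open>\<Sum> (\<alpha>)\<^sub>n / n! p\<^sub>n(x) \<rho>\<^sup>n\<close> is, coefficient by coefficient, the
  expansion of \<open>(1 - \<rho> x)\<^bsup>-\<alpha>\<^esup> F(\<alpha>/2, (\<alpha> + 1)/2; c; (x\<^sup>2 - 1) \<rho>\<^sup>2 / (1 - \<rho> x)\<^sup>2)\<close>
  (\<open>gegen_sum_generating_function\<close>). For general \<open>\<alpha>\<close> and \<open>y = (1 - \<rho> x)/R\<close> the quadratic transformation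
  turns this function into \<open>R\<^bsup>-\<alpha>\<^esup> F(\<alpha>, 2\<mu> - \<alpha>; c; (1 - y)/2)\<close>, which settles the claim for small
  \<open>\<rho>\<close> (\<open>gegen_gf_expansion\<close>).

  To reach every \<open>\<rho>\<close> in \<open>(0, 1)\<close> two things are needed. The series must converge: for \<open>\<alpha> = 2\<mu>\<close> the second
  parameter is \<open>0\<close>, the right-hand side is just \<open>R\<^bsup>-2\<mu>\<^esup>\<close>, which is holomorphic on the unit disc, and
  replacing \<open>(2\<mu>)\<^sub>n\<close> by \<open>(\<alpha>)\<^sub>n\<close> does not shrink the disc of convergence (\<open>fps_conv_radius_gegen_gf\<close>). And
  the two sides must stay equal: along \<open>[0, 1)\<close> the argument \<open>(1 - y)/2\<close> stays inside \<open>[0, 1/2)\<close>, so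
  the identity theorem applies on a neighbourhood of this segment (\<open>gegen_gf_sums\<close>). The resulting
  identity includes \<open>x = \<plusminus>1\<close>, and its right-hand side is continuous in \<open>x\<close> on \<open>[-1, 1]\<close>; this gives
  the limits at the endpoints.

  The transformation formulas are identities of formal power series, proved by
  comparing solutions of the hypergeometric differential equation.
\<close>

(* Formal power series and vectors compete for the same component notation. *)
unbundle no vec_syntax

section \<open>Binomial and hypergeometric power series\<close>

text \<open>The expansion of \<open>(1 - t X)\<^bsup>-s\<^esup>\<close>.\<close>
definition binom_fps :: "'a::field_char_0 \<Rightarrow> 'a \<Rightarrow> 'a fps" where
  "binom_fps t s = Abs_fps (\<lambda>n. pochhammer s n / fact n * t ^ n)"

definition hyp_fps :: "'a::field_char_0 \<Rightarrow> 'a \<Rightarrow> 'a \<Rightarrow> 'a fps" where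
  "hyp_fps a b c = Abs_fps (\<lambda>n. pochhammer a n * pochhammer b n / (pochhammer c n * fact n))"

lemma binom_fps_nth: "binom_fps t s $ n = pochhammer s n / fact n * t ^ n"
  by (simp add: binom_fps_def)

lemma hyp_fps_nth:
  "hyp_fps a b c $ n = pochhammer a n * pochhammer b n / (pochhammer c n * fact n)"
  by (simp add: hyp_fps_def)

lemma hyp_fps_commute: "hyp_fps a b c = hyp_fps b a c"
  by (simp add: hyp_fps_def mult.commute)

lemma binom_fps_0 [simp]: "binom_fps t 0 = 1"
  by (simp add: fps_eq_iff binom_fps_nth pochhammer_0_left)

lemma fps_nth_one_minus_linear_mult:
  "((1 - fps_const t * fps_X) * f) $ n = f $ n - (if n = 0 then 0 else t * f $ (n - 1))"
  for t :: "'a::comm_ring_1"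
  by (simp add: algebra_simps)

lemma binom_fps_reduce: "(1 - fps_const t * fps_X) * binom_fps t (s + 1) = binom_fps t s"
proof (rule fps_ext)
  fix n
  show "((1 - fps_const t * fps_X) * binom_fps t (s + 1)) $ n = binom_fps t s $ n"
  proof (cases n)
    case (Suc m)
    have "pochhammer s (Suc m) = s * pochhammer (s + 1) m"
      by (rule pochhammer_rec)
    moreover have "pochhammer (s + 1) (Suc m) = pochhammer (s + 1) m * (s + 1 + of_nat m)"
      by (simp add: pochhammer_Suc)
    moreover have "(fact m :: 'a) \<noteq> 0" "(1 + of_nat m :: 'a) \<noteq> 0"
      by (simp_all del: of_nat_Suc add: of_nat_Suc[symmetric])
    ultimately show ?thesis
      unfolding fps_nth_one_minus_linear_mult binom_fps_nth Suc
      by (simp add: divide_simps) (simp add: algebra_simps)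
  qed (simp add: binom_fps_nth)
qed

lemma binom_fps_power_reduce:
  "(1 - fps_const t * fps_X) ^ k * binom_fps t (s + of_nat k) = binom_fps t s"
proof (induction k)
  case (Suc k)
  have "(1 - fps_const t * fps_X) ^ Suc k * binom_fps t (s + of_nat (Suc k)) =
        (1 - fps_const t * fps_X) ^ k * ((1 - fps_const t * fps_X) * binom_fps t ((s + of_nat k) + 1))"
    by (simp add: algebra_simps)
  then show ?case
    using Suc by (simp only: binom_fps_reduce)
qed simp

text \<open>Terminating hypergeometric series lead to these exponents, at which the binomial series is a
  polynomial.\<close>
lemma binom_fps_neg_of_nat: "binom_fps t (- of_nat k) = (1 - fps_const t * fps_X) ^ k"
  using binom_fps_power_reduce[of t k "- of_nat k"] by simp

text \<open>The composites below are hypergeometric series in \<open>p / (1 - t X)\<^sup>2\<close> times a power of \<open>1 - t X\<close>.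
  This law merges the two powers; it follows by cancelling \<open>(1 - t X)\<^bsup>2k\<^esup>\<close>.\<close>
lemma binom_fps_mult_even:
  "binom_fps t s * binom_fps t 2 ^ k = binom_fps t (s + 2 * of_nat k)"
proof -
  let ?y = "1 - fps_const t * fps_X"
  have "?y $ 0 \<noteq> 0"
    by simp
  then have nz: "?y \<noteq> 0"
    by (metis fps_zero_nth)
  have "?y ^ 2 * binom_fps t 2 = 1"
    using binom_fps_power_reduce[of t 2 0] by simp
  then have "?y ^ (2 * k) * binom_fps t 2 ^ k = 1"
    by (simp add: power_mult flip: power_mult_distrib)
  then have "?y ^ (2 * k) * (binom_fps t s * binom_fps t 2 ^ k) = binom_fps t s"
    by (simp add: mult.left_commute)
  also have "\<dots> = ?y ^ (2 * k) * binom_fps t (s + 2 * of_nat k)"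
    using binom_fps_power_reduce[of t "2 * k" s] by simp
  finally show ?thesis
    using nz by simp
qed

lemma fps_deriv_binom_fps:
  "(1 - fps_const t * fps_X) * fps_deriv (binom_fps t s) = fps_const (s * t) * binom_fps t s"
proof (rule fps_ext)
  fix n
  have nz: "(fact n :: 'a) \<noteq> 0" "(1 + of_nat n :: 'a) \<noteq> 0" for n
    by (simp_all del: of_nat_Suc add: of_nat_Suc[symmetric])
  have d: "fps_deriv (binom_fps t s) $ n = (s + of_nat n) * t * binom_fps t s $ n" for n
    using nz[of n] by (simp add: binom_fps_nth pochhammer_Suc divide_simps)
  have e: "of_nat (Suc m) * binom_fps t s $ Suc m = (s + of_nat m) * t * binom_fps t s $ m" for m
    using d[of m] by simp
  show "((1 - fps_const t * fps_X) * fps_deriv (binom_fps t s)) $ n = (fps_const (s * t) * binom_fps t s) $ n"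
  proof (cases n)
    case (Suc m)
    then show ?thesis
      unfolding fps_nth_one_minus_linear_mult d using arg_cong[OF e[of m], of "\<lambda>u. t * u"]
      by (simp add: algebra_simps)
  qed (use d[of 0] in \<open>simp add: fps_nth_one_minus_linear_mult\<close>)
qed

text \<open>Since \<open>p\<close> has no constant term, \<open>p ^ k\<close> contributes to coefficient \<open>n\<close> only for \<open>k \<le> n\<close>, so the
  factor \<open>B\<close> can be moved inside a finite sum.\<close>
lemma fps_mult_compose_nth:
  fixes A B p :: "'a::field_char_0 fps"
  assumes "p $ 0 = 0"
  shows "(B * (A oo p)) $ n = (\<Sum>k\<le>n. A $ k * (B * p ^ k) $ n)"
proof -
  have "(A oo p) $ j = (\<Sum>k\<le>n. A $ k * (p ^ k) $ j)" if "j \<le> n" for j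
    unfolding fps_compose_nth
    by (rule sum.mono_neutral_left) (use that startsby_zero_power_prefix[OF assms] in auto)
  then have "(B * (A oo p)) $ n = (\<Sum>i=0..n. B $ i * (\<Sum>k\<le>n. A $ k * (p ^ k) $ (n - i)))"
    by (simp add: fps_mult_nth)
  also have "\<dots> = (\<Sum>i=0..n. \<Sum>k\<le>n. A $ k * (B $ i * (p ^ k) $ (n - i)))"
    by (simp add: sum_distrib_left mult_ac)
  also have "\<dots> = (\<Sum>k\<le>n. \<Sum>i=0..n. A $ k * (B $ i * (p ^ k) $ (n - i)))"
    by (rule sum.swap)
  also have "\<dots> = (\<Sum>k\<le>n. A $ k * (B * p ^ k) $ n)"
    by (simp add: fps_mult_nth sum_distrib_left)
  finally show ?thesis .
qed

lemma binom_fps_mult_compose_nth: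
  assumes "p $ 0 = 0"
  shows "(binom_fps t s * (A oo (p * binom_fps t 2))) $ n =
         (\<Sum>k\<le>n. A $ k * (p ^ k * binom_fps t (s + 2 * of_nat k)) $ n)"
proof -
  have "binom_fps t s * (p * binom_fps t 2) ^ k = p ^ k * binom_fps t (s + 2 * of_nat k)" for k
    using binom_fps_mult_even[of t s k] by (simp add: power_mult_distrib mult_ac)
  with assms show ?thesis
    by (simp add: fps_mult_compose_nth)
qed

section \<open>The hypergeometric differential equation\<close>

definition hyp_ode :: "'a::field_char_0 \<Rightarrow> 'a \<Rightarrow> 'a \<Rightarrow> 'a fps \<Rightarrow> bool" where
  "hyp_ode a b c G \<longleftrightarrow>
     fps_X * (1 - fps_X) * fps_deriv (fps_deriv G)
       + (fps_const c - fps_const (a + b + 1) * fps_X) * fps_deriv G = fps_const (a * b) * G"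

text \<open>On coefficients the differential equation is a two-term recurrence. If \<open>c\<close> is not a non-positive
  integer it determines \<open>G\<close> from its constant term, which makes it a test for hypergeometric
  series.\<close>
lemma hyp_ode_iff:
  "hyp_ode a b c G \<longleftrightarrow>
     (\<forall>n. (of_nat n + 1) * (of_nat n + c) * G $ Suc n = (of_nat n + a) * (of_nat n + b) * G $ n)"
proof -
  define L where "L = fps_X * (1 - fps_X) * fps_deriv (fps_deriv G)
       + (fps_const c - fps_const (a + b + 1) * fps_X) * fps_deriv G - fps_const (a * b) * G"
  have L: "L = fps_X * fps_deriv (fps_deriv G) - fps_X * (fps_X * fps_deriv (fps_deriv G)) +
      fps_const c * fps_deriv G - fps_const (a + b + 1) * (fps_X * fps_deriv G) - fps_const (a * b) * G"
    unfolding L_def by (simp add: algebra_simps)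
  have nth: "L $ n = (of_nat n + 1) * (of_nat n + c) * G $ Suc n - (of_nat n + a) * (of_nat n + b) * G $ n" for n
  proof -
    consider "n = 0" | "n = 1" | m where "n = Suc (Suc m)"
      by (metis One_nat_def not0_implies_Suc)
    then show ?thesis
      by cases (simp_all add: L, simp_all add: algebra_simps)
  qed
  have "hyp_ode a b c G \<longleftrightarrow> L = 0"
    unfolding hyp_ode_def L_def by (rule eq_iff_diff_eq_0)
  also have "\<dots> \<longleftrightarrow> (\<forall>n. L $ n = 0)"
    by (simp add: fps_eq_iff)
  finally show ?thesis
    unfolding nth by (simp only: eq_iff_diff_eq_0[symmetric])
qed

lemma hyp_fps_satisfies_ode:
  assumes "\<And>n. c + of_nat n \<noteq> (0 :: 'a::field_char_0)"
  shows "hyp_ode a b c (hyp_fps a b c)"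
  unfolding hyp_ode_iff
proof
  fix n
  have "pochhammer c n \<noteq> 0"
    using assms by (auto simp: pochhammer_eq_0_iff eq_neg_iff_add_eq_0)
  moreover have "(fact n :: 'a) \<noteq> 0" "(1 + of_nat n :: 'a) \<noteq> 0"
    by (simp_all del: of_nat_Suc add: of_nat_Suc[symmetric])
  ultimately show "(of_nat n + 1) * (of_nat n + c) * hyp_fps a b c $ Suc n =
        (of_nat n + a) * (of_nat n + b) * hyp_fps a b c $ n"
    using assms[of n] by (simp add: hyp_fps_nth pochhammer_Suc divide_simps) (simp add: algebra_simps)
qed

lemma hyp_ode_unique:
  assumes c: "\<And>n. c + of_nat n \<noteq> (0 :: 'a::field_char_0)"
    and ode: "hyp_ode a b c G" and init: "G $ 0 = 1"
  shows "G = hyp_fps a b c"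
proof (rule fps_ext)
  fix n show "G $ n = hyp_fps a b c $ n"
  proof (induction n)
    case (Suc n)
    have rec: "(of_nat n + 1) * (of_nat n + c) * F $ Suc n = (of_nat n + a) * (of_nat n + b) * F $ n"
      if "hyp_ode a b c F" for F
      using that by (simp add: hyp_ode_iff)
    have "(of_nat n + 1) * (of_nat n + c) \<noteq> 0"
      using c[of n] by (simp add: add.commute del: of_nat_Suc add: of_nat_Suc[symmetric])
    with rec[OF ode] rec[OF hyp_fps_satisfies_ode[OF c]] Suc show ?case
      by (metis mult_left_cancel)
  qed (simp add: init hyp_fps_nth)
qed

text \<open>Euler's transformation. The right-hand side solves the hypergeometric equation with parameters
  \<open>a, b, c\<close>: with \<open>E = (1 - X)\<^bsup>c - a - b\<^esup>\<close>, substitute \<open>E * h\<close> and eliminate the derivatives of \<open>E\<close> by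
  \<open>(1 - X) E' = (a + b - c) E\<close> and the second derivative of \<open>h\<close> by its own equation.\<close>
theorem hyp_fps_euler:
  fixes a b c :: "'a::field_char_0"
  assumes c: "\<And>n. c + of_nat n \<noteq> 0"
  shows "hyp_fps a b c = binom_fps 1 (a + b - c) * hyp_fps (c - a) (c - b) c"
proof (rule sym, rule hyp_ode_unique[OF c])
  define E h X where "E = binom_fps 1 (a + b - c)" and "h = hyp_fps (c - a) (c - b) c"
    and "X = (fps_X :: 'a fps)"
  let ?k = fps_const
  let ?D = fps_deriv
  have E: "(1 - X) * ?D E = (?k a + ?k b - ?k c) * E"
    using fps_deriv_binom_fps[of 1 "a + b - c"] by (simp add: E_def X_def)
  have k1: "?k (c - a + (c - b) + 1) = 2 * ?k c - ?k a - ?k b + 1"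
    by (simp add: fps_eq_iff fps_numeral_nth)
  have k2: "?k ((c - a) * (c - b)) = (?k c - ?k a) * (?k c - ?k b)"
    by simp
  have h: "X * (1 - X) * ?D (?D h) + (?k c - (2 * ?k c - ?k a - ?k b + 1) * X) * ?D h
            = (?k c - ?k a) * (?k c - ?k b) * h"
    using hyp_fps_satisfies_ode[OF c, of "c - a" "c - b"]
    unfolding hyp_ode_def h_def[symmetric] X_def[symmetric] k1 k2 .
  have E2: "(1 - X) * ?D (?D E) = (?k a + ?k b - ?k c + 1) * ?D E"
    using arg_cong[OF E, of ?D] by (simp add: X_def algebra_simps)
  have "(1 - X) * (X * (1 - X) * ?D (?D (E * h)) + (?k c - (?k a + ?k b + 1) * X) * ?D (E * h)
          - ?k a * ?k b * (E * h))
      = X * h * (1 - X) * ((1 - X) * ?D (?D E))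
        + (2 * X * (1 - X) * ?D h + (?k c - (?k a + ?k b + 1) * X) * h) * ((1 - X) * ?D E)
        + (1 - X) * E * (X * (1 - X) * ?D (?D h))
        + (1 - X) * E * ((?k c - (?k a + ?k b + 1) * X) * ?D h - ?k a * ?k b * h)"
    by (simp add: algebra_simps)
  also have "X * h * (1 - X) * ((1 - X) * ?D (?D E)) = X * h * (?k a + ?k b - ?k c + 1) * ((1 - X) * ?D E)"
    unfolding E2 by (simp only: mult_ac)
  also have "X * (1 - X) * ?D (?D h) = (?k c - ?k a) * (?k c - ?k b) * h
      - (?k c - (2 * ?k c - ?k a - ?k b + 1) * X) * ?D h"
    using h by (simp only: eq_diff_eq)
  also have "X * h * (?k a + ?k b - ?k c + 1) * ((1 - X) * ?D E)
        + (2 * X * (1 - X) * ?D h + (?k c - (?k a + ?k b + 1) * X) * h) * ((1 - X) * ?D E)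
        + (1 - X) * E * ((?k c - ?k a) * (?k c - ?k b) * h
            - (?k c - (2 * ?k c - ?k a - ?k b + 1) * X) * ?D h)
        + (1 - X) * E * ((?k c - (?k a + ?k b + 1) * X) * ?D h - ?k a * ?k b * h) = 0"
    unfolding E by (simp add: algebra_simps del: fps_const_add fps_const_sub fps_const_mult)
  finally have "(1 - X) * (X * (1 - X) * ?D (?D (E * h)) + (?k c - (?k a + ?k b + 1) * X) * ?D (E * h)
          - ?k a * ?k b * (E * h)) = 0" .
  moreover have "1 - X \<noteq> 0"
    by (metis X_def diff_zero fps_X_nth fps_one_nth fps_sub_nth fps_zero_nth zero_neq_one)
  ultimately have "X * (1 - X) * ?D (?D (E * h)) + (?k c - (?k a + ?k b + 1) * X) * ?D (E * h)
          = ?k a * ?k b * (E * h)"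
    by simp
  then show "hyp_ode a b c (binom_fps 1 (a + b - c) * hyp_fps (c - a) (c - b) c)"
    unfolding hyp_ode_def E_def h_def X_def by (simp flip: fps_const_add fps_const_sub fps_const_mult)
qed (simp add: binom_fps_nth hyp_fps_nth)

text \<open>The quadratic transformation. In terms of \<open>y = 1 - 2 X\<close> the inner series is \<open>w = 1 - 1 / y\<^sup>2\<close>, so
  the right-hand side is \<open>y\<^bsup>-\<alpha>\<^esup> F(\<alpha>/2, (\<alpha> + 1)/2; c; 1 - 1 / y\<^sup>2)\<close>. It solves the
  equation of the left-hand side by the chain rule. Division is avoided by multiplying with powers of
  \<open>y\<close>, which are cancelled at the end.\<close>
theorem hyp_fps_quadratic:
  fixes \<alpha> c :: "'a::field_char_0"
  assumes c: "\<And>n. c + of_nat n \<noteq> 0"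
  shows "hyp_fps \<alpha> (2 * c - 1 - \<alpha>) c =
    binom_fps 2 \<alpha> * (hyp_fps (\<alpha> / 2) ((\<alpha> + 1) / 2) c oo (- 4 * fps_X * (1 - fps_X) * binom_fps 2 2))"
proof (rule sym, rule hyp_ode_unique[OF c])
  define X where "X = (fps_X :: 'a fps)"
  define E A w where "E = binom_fps 2 \<alpha>" and "A = hyp_fps (\<alpha> / 2) ((\<alpha> + 1) / 2) c"
    and "w = - 4 * X * (1 - X) * binom_fps 2 2"
  define y where "y = 1 - 2 * X"
  define f0 f1 f2 where "f0 = A oo w" and "f1 = fps_deriv A oo w" and "f2 = fps_deriv (fps_deriv A) oo w"
  let ?k = fps_const
  let ?D = fps_deriv
  have [simp]: "?D y = -2" "?D X = 1"
    by (simp_all add: y_def X_def)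
  have y_alt: "1 - ?k 2 * fps_X = y"
    by (simp add: y_def X_def numeral_fps_const)
  have ynz: "y \<noteq> 0"
  proof -
    have "y $ 0 \<noteq> 0" by (simp add: y_def X_def)
    then show ?thesis by (metis fps_zero_nth)
  qed
  have w0: "w $ 0 = 0"
    by (simp add: w_def X_def)
  have "y ^ 2 * binom_fps 2 2 = 1"
    using binom_fps_power_reduce[of "2 :: 'a" 2 0] unfolding y_alt by simp
  then have w: "y ^ 2 * (1 - w) = 1"
    unfolding w_def y_def by algebra
  have "y * (y * ?D w - 4 * (w - 1)) = 0"
    using arg_cong[OF w, of ?D] by (simp add: power2_eq_square algebra_simps)
  then have "y * ?D w = 4 * (w - 1)"
    using ynz by simp
  then have Dw: "y ^ 3 * ?D w = - 4"
    using w by algebra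
  have E: "y * ?D E = 2 * ?k \<alpha> * E"
    using fps_deriv_binom_fps[of "2 :: 'a" \<alpha>] unfolding y_alt E_def[symmetric]
    by (simp flip: fps_const_mult add: numeral_fps_const mult.commute)
  have Df: "?D f0 = f1 * ?D w" "?D f1 = f2 * ?D w"
    unfolding f0_def f1_def f2_def by (simp_all add: fps_compose_deriv[OF w0])
  define G where "G = E * f0"
  (* First and second derivative of y^(-\<alpha>) f(w), where f0, f1, f2 are f, f', f'' at w. *)
  have G1: "y ^ 3 * ?D G = 2 * ?k \<alpha> * y ^ 2 * G - 4 * (E * f1)"
    unfolding G_def fps_deriv_mult Df using E Dw by algebra
  have "?D (y ^ 3 * ?D G) = ?D (2 * ?k \<alpha> * y ^ 2 * G - 4 * (E * f1))"
    by (simp only: G1)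
  then have "y ^ 3 * ?D (?D G) - 6 * y ^ 2 * ?D G =
      2 * ?k \<alpha> * y ^ 2 * ?D G - 8 * ?k \<alpha> * y * G - 4 * (?D E * f1) - 4 * (E * (f2 * ?D w))"
    by (simp add: power2_eq_square power3_eq_cube Df algebra_simps)
  then have G2: "y ^ 6 * ?D (?D G) - 6 * y ^ 5 * ?D G =
      2 * ?k \<alpha> * y ^ 5 * ?D G - 8 * ?k \<alpha> * y ^ 4 * G - 8 * ?k \<alpha> * y ^ 2 * (E * f1) + 16 * (E * f2)"
    using E Dw by algebra
  have ode_A: "fps_X * (1 - fps_X) * fps_deriv (fps_deriv A)
     + (?k c - ?k (\<alpha> / 2 + (\<alpha> + 1) / 2 + 1) * fps_X) * fps_deriv A
     = ?k (\<alpha> / 2 * ((\<alpha> + 1) / 2)) * A"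
    using hyp_fps_satisfies_ode[OF c] unfolding hyp_ode_def A_def .
  have "w * (1 - w) * f2 + (?k c - ?k (\<alpha> / 2 + (\<alpha> + 1) / 2 + 1) * w) * f1
     = ?k (\<alpha> / 2 * ((\<alpha> + 1) / 2)) * f0"
    using arg_cong[OF ode_A, of "\<lambda>f. f oo w"] w0
    by (simp add: fps_compose_mult_distrib fps_compose_add_distrib fps_compose_sub_distrib
          f0_def f1_def f2_def)
  (* The factor 4 clears the halves in the parameters \<alpha>/2 and (\<alpha> + 1)/2. *)
  then have "?k 4 * (w * (1 - w) * f2 + (?k c - ?k (\<alpha> / 2 + (\<alpha> + 1) / 2 + 1) * w) * f1)
     = ?k 4 * (?k (\<alpha> / 2 * ((\<alpha> + 1) / 2)) * f0)"
    by simp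
  moreover have "?k 4 * ?k (\<alpha> / 2 + (\<alpha> + 1) / 2 + 1) = 4 * ?k \<alpha> + 6"
    by (simp add: numeral_fps_const field_simps)
  moreover have "?k 4 * ?k (\<alpha> / 2 * ((\<alpha> + 1) / 2)) = ?k \<alpha> * (?k \<alpha> + 1)"
    by (simp flip: fps_const_1_eq_1 add: field_simps)
  moreover have "?k (4::'a) = 4"
    by (simp add: numeral_fps_const)
  ultimately have f: "4 * (w * (1 - w) * f2) + (4 * ?k c - (4 * ?k \<alpha> + 6) * w) * f1
     = ?k \<alpha> * (?k \<alpha> + 1) * f0"
    by algebra
  define q where "q = X * (1 - X)"
  have q: "y ^ 2 = 1 - 4 * q"
    unfolding q_def y_def by algebra
  then have yw: "y ^ 2 * w = - 4 * q"
    using w by algebra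
  have f': "- 16 * q * (E * f2) + (4 * ?k c * y ^ 4 + 4 * (4 * ?k \<alpha> + 6) * q * y ^ 2) * (E * f1)
     = ?k \<alpha> * (?k \<alpha> + 1) * y ^ 4 * G"
    unfolding G_def using f w yw by algebra
  have "y ^ 6 * (q * ?D (?D G) + ?k c * y * ?D G - ?k \<alpha> * (2 * ?k c - 1 - ?k \<alpha>) * G) = 0"
    using G1 G2 f' q by algebra
  then have "q * ?D (?D G) + ?k c * y * ?D G = ?k \<alpha> * (2 * ?k c - 1 - ?k \<alpha>) * G"
    using ynz by simp
  moreover have "?k (\<alpha> + (2 * c - 1 - \<alpha>) + 1) = 2 * ?k c"
    by (simp add: numeral_fps_const)
  moreover have "?k (\<alpha> * (2 * c - 1 - \<alpha>)) = ?k \<alpha> * (2 * ?k c - 1 - ?k \<alpha>)"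
    by (simp add: numeral_fps_const flip: fps_const_1_eq_1)
  ultimately have "hyp_ode \<alpha> (2 * c - 1 - \<alpha>) c G"
    unfolding hyp_ode_def X_def[symmetric] q_def y_def by algebra
  then show "hyp_ode \<alpha> (2 * c - 1 - \<alpha>) c (binom_fps 2 \<alpha> *
     (hyp_fps (\<alpha> / 2) ((\<alpha> + 1) / 2) c oo (- 4 * fps_X * (1 - fps_X) * binom_fps 2 2)))"
    by (simp add: G_def f0_def E_def A_def w_def X_def)
qed (simp add: binom_fps_nth hyp_fps_nth)

section \<open>The Laplace form of the Gegenbauer polynomials\<close>

lemma hyp_fps_half_nth:
  "hyp_fps (\<alpha> / 2) ((\<alpha> + 1) / 2) c $ k = pochhammer \<alpha> (2 * k) / (4 ^ k * pochhammer c k * fact k)"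
  using pochhammer_double[of "\<alpha> / 2" k]
  by (simp add: hyp_fps_nth power_mult add_divide_distrib)

lemma pochhammer_neg_of_nat:
  assumes "m \<le> n"
  shows "pochhammer (- of_nat n :: 'a::field_char_0) m = (- 1) ^ m * fact n / fact (n - m)"
proof -
  have "(fact n :: 'a) = fact (n - m) * pochhammer (of_nat n - of_nat m + 1) m"
    using pochhammer_product[of "n - m" n "1 :: 'a"] assms
    by (simp add: pochhammer_fact of_nat_diff add.commute)
  then show ?thesis
    by (simp add: pochhammer_minus)
qed

text \<open>The Gegenbauer polynomial \<open>C\<^sub>n\<^sup>\<mu>(x)\<close> for \<open>c = \<mu> + 1/2\<close>, normalised to the value \<open>1\<close> at \<open>x = 1\<close>
  and written as a sum of products of powers of \<open>x\<^sup>2 - 1\<close> and \<open>x\<close>.\<close>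
definition gegen_sum :: "'a::field_char_0 \<Rightarrow> nat \<Rightarrow> 'a \<Rightarrow> 'a" where
  "gegen_sum c n x =
     (\<Sum>k\<le>n div 2. fact n / (4 ^ k * pochhammer c k * fact k * fact (n - 2 * k))
        * (x\<^sup>2 - 1) ^ k * x ^ (n - 2 * k))"

text \<open>The quadratic transformation at \<open>\<alpha> = -n\<close>. The inner series stops at \<open>k = n div 2\<close>, because
  \<open>(-n)\<^bsub>2k\<^esub>\<close> vanishes beyond, and the surviving powers of \<open>1 - 2 X\<close> have exponent \<open>n - 2 k \<ge> 0\<close>. Thus
  the identity is one between polynomials and holds for every argument, also outside the disc where the
  composition converges.\<close>
lemma hyp_fps_terminating:
  fixes c :: "'a::field_char_0"
  assumes c: "\<And>n. c + of_nat n \<noteq> 0"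
  shows "hyp_fps (- of_nat n) (2 * c - 1 + of_nat n) c =
    fps_of_poly (\<Sum>k\<le>n div 2. smult (fact n / (4 ^ k * pochhammer c k * fact k * fact (n - 2 * k)))
                   ([:0, -4, 4:] ^ k * [:1, -2:] ^ (n - 2 * k)))"
proof (rule fps_ext)
  fix N
  define A where "A = hyp_fps (- of_nat n / 2) ((- of_nat n + 1) / 2) c"
  define p :: "'a fps" where "p = - 4 * fps_X * (1 - fps_X)"
  define B :: "nat \<Rightarrow> 'a fps" where "B = (\<lambda>k. p ^ k * binom_fps 2 (- of_nat n + 2 * of_nat k))"
  have p0: "p $ 0 = 0"
    by (simp add: p_def)
  have p_poly: "fps_of_poly [:0, -4, 4:] = p"
    by (simp add: p_def fps_of_poly_pCons numeral_fps_const algebra_simps fps_const_neg[symmetric] del: fps_const_neg)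
  have y_poly: "fps_of_poly [:1, -2:] = 1 - fps_const (2::'a) * fps_X"
    by (simp add: fps_of_poly_pCons fps_const_neg[symmetric] del: fps_const_neg)
  have "hyp_fps (- of_nat n) (2 * c - 1 + of_nat n) c $ N = (\<Sum>k\<le>N. A $ k * B k $ N)"
    using hyp_fps_quadratic[OF c, of "- of_nat n"] binom_fps_mult_compose_nth[OF p0, of 2 "- of_nat n" A N]
    by (simp add: A_def B_def p_def)
  (* Two truncations of the same sum: p ^ k has order at least k, and A $ k = 0 for k > n div 2. *)
  also have "\<dots> = (\<Sum>k\<le>max N (n div 2). A $ k * B k $ N)"
  proof (rule sum.mono_neutral_left)
    have "B k $ N = 0" if "k > N" for k
      using startsby_zero_power_prefix[OF p0, of k] that by (simp add: B_def fps_mult_nth)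
    then show "\<forall>k\<in>{..max N (n div 2)} - {..N}. A $ k * B k $ N = 0"
      by auto
  qed auto
  also have "\<dots> = (\<Sum>k\<le>n div 2. A $ k * B k $ N)"
  proof (rule sum.mono_neutral_right)
    have "A $ k = 0" if "k > n div 2" for k
      using that unfolding A_def hyp_fps_half_nth
      by (simp add: pochhammer_of_nat_eq_0_lemma)
    then show "\<forall>k\<in>{..max N (n div 2)} - {..n div 2}. A $ k * B k $ N = 0"
      by auto
  qed auto
  also have "\<dots> = (\<Sum>k\<le>n div 2. fps_of_poly (smult (fact n / (4 ^ k * pochhammer c k * fact k * fact (n - 2 * k)))
                   ([:0, -4, 4:] ^ k * [:1, -2:] ^ (n - 2 * k))) $ N)"
  proof (rule sum.cong)
    fix k assume "k \<in> {..n div 2}"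
    then have k: "2 * k \<le> n" by auto
    have "binom_fps (2::'a) (- of_nat n + 2 * of_nat k) = binom_fps 2 (- of_nat (n - 2 * k))"
      using k by (simp add: of_nat_diff)
    then have "B k = fps_of_poly ([:0, -4, 4:] ^ k * [:1, -2:] ^ (n - 2 * k))"
      by (simp only: B_def binom_fps_neg_of_nat fps_of_poly_mult fps_of_poly_power p_poly y_poly)
    moreover have "A $ k = fact n / (4 ^ k * pochhammer c k * fact k * fact (n - 2 * k))"
      unfolding A_def hyp_fps_half_nth pochhammer_neg_of_nat[OF k] by (simp add: mult_ac)
    ultimately show "A $ k * B k $ N = fps_of_poly (smult (fact n / (4 ^ k * pochhammer c k * fact k * fact (n - 2 * k)))
                   ([:0, -4, 4:] ^ k * [:1, -2:] ^ (n - 2 * k))) $ N"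
      by simp
  qed simp
  finally show "hyp_fps (- of_nat n) (2 * c - 1 + of_nat n) c $ N = fps_of_poly (\<Sum>k\<le>n div 2. smult (fact n / (4 ^ k * pochhammer c k * fact k * fact (n - 2 * k)))
                   ([:0, -4, 4:] ^ k * [:1, -2:] ^ (n - 2 * k))) $ N"
    by (simp add: coeff_sum)
qed

lemma eval_hyp_fps_terminating:
  fixes c x :: complex
  assumes c: "\<And>n. c + of_nat n \<noteq> 0"
  shows "eval_fps (hyp_fps (- of_nat n) (2 * c - 1 + of_nat n) c) ((1 - x) / 2) = gegen_sum c n x"
proof -
  have "poly [:0, -4, 4:] ((1 - x) / 2) = x\<^sup>2 - 1"
    by (simp add: power2_eq_square field_simps)
  moreover have "poly [:1, -2:] ((1 - x) / 2) = x"
    by (simp add: field_simps)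
  ultimately show ?thesis
    unfolding hyp_fps_terminating[OF c] eval_fps_of_poly gegen_sum_def
    by (simp only: poly_sum poly_smult poly_mult poly_power mult.assoc)
qed

definition gegen_gf :: "'a::field_char_0 \<Rightarrow> 'a \<Rightarrow> 'a \<Rightarrow> 'a fps" where
  "gegen_gf \<alpha> c x = Abs_fps (\<lambda>n. pochhammer \<alpha> n / fact n * gegen_sum c n x)"

text \<open>The coefficient of \<open>X\<^sup>n\<close> on the left collects the terms with \<open>2 k \<le> n\<close>. There
  \<open>(\<alpha>)\<^bsub>2k\<^esub> (\<alpha> + 2k)\<^bsub>n - 2k\<^esub> = (\<alpha>)\<^sub>n\<close>, so \<open>\<alpha>\<close> factors out and the Laplace form remains.\<close>
theorem gegen_sum_generating_function:
  "binom_fps x \<alpha> * (hyp_fps (\<alpha> / 2) ((\<alpha> + 1) / 2) c oo (fps_const (x\<^sup>2 - 1) * fps_X\<^sup>2 * binom_fps x 2))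
     = gegen_gf \<alpha> c x"
proof (rule fps_ext)
  fix n
  define A where "A = hyp_fps (\<alpha> / 2) ((\<alpha> + 1) / 2) c"
  define p where "p = fps_const (x\<^sup>2 - 1) * fps_X\<^sup>2"
  define B where "B = (\<lambda>k. p ^ k * binom_fps x (\<alpha> + 2 * of_nat k))"
  have p0: "p $ 0 = 0"
    by (simp add: p_def)
  have "B k = fps_const ((x\<^sup>2 - 1) ^ k) * (fps_X ^ (2 * k) * binom_fps x (\<alpha> + 2 * of_nat k))" for k
    by (simp add: B_def p_def power_mult_distrib power_mult fps_const_power mult.assoc)
  then have B: "B k $ n = (if n < 2 * k then 0 else (x\<^sup>2 - 1) ^ k *
      (pochhammer (\<alpha> + 2 * of_nat k) (n - 2 * k) / fact (n - 2 * k) * x ^ (n - 2 * k)))" for k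
    by (simp add: fps_X_power_mult_nth binom_fps_nth)
  have "(binom_fps x \<alpha> * (A oo (p * binom_fps x 2))) $ n = (\<Sum>k\<le>n. A $ k * B k $ n)"
    using binom_fps_mult_compose_nth[OF p0] by (simp add: B_def)
  also have "\<dots> = (\<Sum>k\<le>n div 2. A $ k * B k $ n)"
    by (rule sum.mono_neutral_right) (auto simp: B)
  also have "\<dots> = (\<Sum>k\<le>n div 2. pochhammer \<alpha> n / fact n *
        (fact n / (4 ^ k * pochhammer c k * fact k * fact (n - 2 * k)) * (x\<^sup>2 - 1) ^ k * x ^ (n - 2 * k)))"
  proof (rule sum.cong)
    fix k assume "k \<in> {..n div 2}"
    then have k: "2 * k \<le> n" by auto
    have "pochhammer \<alpha> n = pochhammer \<alpha> (2 * k) * pochhammer (\<alpha> + 2 * of_nat k) (n - 2 * k)"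
      using pochhammer_product[OF k, of \<alpha>] by simp
    then show "A $ k * B k $ n = pochhammer \<alpha> n / fact n *
        (fact n / (4 ^ k * pochhammer c k * fact k * fact (n - 2 * k)) * (x\<^sup>2 - 1) ^ k * x ^ (n - 2 * k))"
      using k by (simp add: B A_def hyp_fps_half_nth)
  qed simp
  finally show "(binom_fps x \<alpha> * (hyp_fps (\<alpha> / 2) ((\<alpha> + 1) / 2) c oo (fps_const (x\<^sup>2 - 1) * fps_X\<^sup>2 * binom_fps x 2))) $ n
     = gegen_gf \<alpha> c x $ n"
    by (simp add: A_def p_def gegen_gf_def gegen_sum_def sum_distrib_left)
qed

section \<open>Convergence and the analytic transformation formulas\<close>

lemma summable_hyp_fps:
  fixes a b c z :: complex
  assumes c: "\<And>n. c + of_nat n \<noteq> 0" and z: "norm z < 1"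
  shows "summable (\<lambda>n. hyp_fps a b c $ n * z ^ n)"
proof -
  define q where "q n = (a + of_nat n) * (b + of_nat n) / ((c + of_nat n) * (1 + of_nat n)) * z" for n
  have step: "hyp_fps a b c $ Suc n * z ^ Suc n = q n * (hyp_fps a b c $ n * z ^ n)" for n
    by (simp add: hyp_fps_nth q_def pochhammer_Suc mult_ac)
  have lim: "(\<lambda>n. (u + of_nat n) / (v + of_nat n)) \<longlonglongrightarrow> 1" for u v :: complex
  proof -
    have "(\<lambda>n. (u / of_nat n + 1) / (v / of_nat n + 1)) \<longlonglongrightarrow> (0 + 1) / (0 + 1)"
      by (intro tendsto_intros lim_const_over_n) auto
    moreover have "\<forall>\<^sub>F n in sequentially. (u / of_nat n + 1) / (v / of_nat n + 1) = (u + of_nat n) / (v + of_nat n)"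
      using eventually_gt_at_top[of 0] by eventually_elim (simp add: divide_simps)
    ultimately show ?thesis
      by (simp add: Lim_transform_eventually)
  qed
  have "(\<lambda>n. norm ((a + of_nat n) / (c + of_nat n) * ((b + of_nat n) / (1 + of_nat n)) * z)) \<longlonglongrightarrow> norm (1 * 1 * z)"
    by (intro tendsto_intros lim)
  then have "(\<lambda>n. norm (q n)) \<longlonglongrightarrow> norm z"
    by (simp add: q_def)
  moreover obtain r where r: "norm z < r" "r < 1"
    using dense[OF z] by blast
  ultimately have "\<forall>\<^sub>F n in sequentially. norm (q n) < r"
    by (intro order_tendstoD)
  then obtain N where N: "\<And>n. n \<ge> N \<Longrightarrow> norm (q n) < r"
    unfolding eventually_sequentially by blast
  show ?thesis
  proof (rule summable_ratio_test[OF r(2)])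
    fix n assume "n \<ge> N"
    then show "norm (hyp_fps a b c $ Suc n * z ^ Suc n) \<le> r * norm (hyp_fps a b c $ n * z ^ n)"
      unfolding step norm_mult[of "q n"] using less_imp_le[OF N[of n]] by (intro mult_right_mono) auto
  qed
qed

lemma fps_conv_radius_hyp_fps:
  fixes a b c :: complex
  assumes "\<And>n. c + of_nat n \<noteq> 0"
  shows "fps_conv_radius (hyp_fps a b c) \<ge> 1"
  unfolding fps_conv_radius_def
  by (rule conv_radius_geI_ex') (use assms in \<open>auto intro!: summable_hyp_fps\<close>)

lemma norm_less_conv_radius_hyp_fps:
  fixes a b c z :: complex
  assumes "\<And>n. c + of_nat n \<noteq> 0" "norm z < 1"
  shows "ereal (norm z) < fps_conv_radius (hyp_fps a b c)"
proof -
  have "ereal (norm z) < 1"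
    using assms(2) by simp
  also have "1 \<le> fps_conv_radius (hyp_fps a b c)"
    using assms(1) by (rule fps_conv_radius_hyp_fps)
  finally show ?thesis .
qed

lemma hyp_fps_has_expansion:
  fixes a b c :: complex
  assumes "\<And>n. c + of_nat n \<noteq> 0"
  shows "eval_fps (hyp_fps a b c) has_fps_expansion hyp_fps a b c"
  using norm_less_conv_radius_hyp_fps[OF assms, of 0]
  by (intro eval_fps_has_fps_expansion) (simp add: zero_ereal_def)

lemma binom_fps_sums:
  fixes t s z :: complex
  assumes "norm (t * z) < 1"
  shows "(\<lambda>n. binom_fps t s $ n * z ^ n) sums (1 - t * z) powr (- s)"
proof -
  have "(- s gchoose n) * (- (t * z)) ^ n = binom_fps t s $ n * z ^ n" for n
    by (simp add: gbinomial_pochhammer binom_fps_nth power_mult_distrib power_minus[of "t * z"])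
  with gen_binomial_complex[of "- (t * z)" "- s"] assms show ?thesis
    by simp
qed

lemma powr_has_fps_expansion_binom_fps:
  fixes t s :: complex
  shows "(\<lambda>z. (1 - t * z) powr (- s)) has_fps_expansion binom_fps t s"
proof (rule has_fps_expansionI)
  have "(\<lambda>z. norm (t * z)) \<midarrow>0\<rightarrow> norm (t * 0)"
    by (intro tendsto_intros)
  then have "((\<lambda>z. norm (t * z)) \<longlongrightarrow> norm (t * 0)) (nhds 0)"
    by (simp add: tendsto_nhds_iff)
  then have "\<forall>\<^sub>F z in nhds 0. norm (t * z) < 1"
    by (rule order_tendstoD) simp
  then show "\<forall>\<^sub>F z in nhds 0. (\<lambda>n. binom_fps t s $ n * z ^ n) sums (1 - t * z) powr (- s)"
    by eventually_elim (rule binom_fps_sums)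
qed

theorem eval_hyp_fps_euler:
  fixes a b c z :: complex
  assumes c: "\<And>n. c + of_nat n \<noteq> 0" and z: "norm z < 1"
  shows "eval_fps (hyp_fps a b c) z = (1 - z) powr (c - a - b) * eval_fps (hyp_fps (c - a) (c - b) c) z"
proof -
  have "fps_conv_radius (binom_fps 1 (a + b - c)) \<ge> 1"
    unfolding fps_conv_radius_def
    by (rule conv_radius_geI_ex') (use binom_fps_sums[of 1 _ "a + b - c"] in \<open>auto simp: sums_iff\<close>)
  moreover have "ereal (norm z) < 1"
    using z by simp
  ultimately have "ereal (norm z) < fps_conv_radius (binom_fps 1 (a + b - c))"
    by (rule less_le_trans[rotated])
  moreover have "eval_fps (binom_fps 1 (a + b - c)) z = (1 - z) powr (c - a - b)"
    using binom_fps_sums[of 1 z "a + b - c"] z by (simp add: eval_fps_def sums_iff algebra_simps)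
  ultimately show ?thesis
    by (subst hyp_fps_euler[OF c])
      (simp add: eval_fps_mult norm_less_conv_radius_hyp_fps[OF c z])
qed

text \<open>Only a neighbourhood of \<open>0\<close> is claimed: the inner argument leaves the unit disc as
  \<open>z\<close> approaches \<open>1/2\<close>.\<close>
lemma hyp_fps_quadratic_near_0:
  fixes \<alpha> c :: complex
  assumes c: "\<And>n. c + of_nat n \<noteq> 0"
  shows "\<forall>\<^sub>F z in nhds 0. eval_fps (hyp_fps \<alpha> (2 * c - 1 - \<alpha>) c) z =
     (1 - 2 * z) powr (- \<alpha>) * eval_fps (hyp_fps (\<alpha> / 2) ((\<alpha> + 1) / 2) c) (- 4 * z * (1 - z) / (1 - 2 * z)\<^sup>2)"
proof -
  define A where "A = hyp_fps (\<alpha> / 2) ((\<alpha> + 1) / 2) c"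
  define p where "p = (\<lambda>z::complex. - 4 * z * (1 - z) * (1 - 2 * z) powr (- 2))"
  have "p has_fps_expansion (- 4 * fps_X * (1 - fps_X) * binom_fps 2 2)"
    unfolding p_def by (intro fps_expansion_intros powr_has_fps_expansion_binom_fps)
  then have "(eval_fps A \<circ> p) has_fps_expansion (A oo (- 4 * fps_X * (1 - fps_X) * binom_fps 2 2))"
    unfolding A_def by (intro has_fps_expansion_compose hyp_fps_has_expansion c) simp_all
  then have "(\<lambda>z. (1 - 2 * z) powr (- \<alpha>) * (eval_fps A \<circ> p) z) has_fps_expansion
      binom_fps 2 \<alpha> * (A oo (- 4 * fps_X * (1 - fps_X) * binom_fps 2 2))"
    by (intro has_fps_expansion_mult powr_has_fps_expansion_binom_fps)
  then have "(\<lambda>z. (1 - 2 * z) powr (- \<alpha>) * eval_fps A (p z)) has_fps_expansion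
      hyp_fps \<alpha> (2 * c - 1 - \<alpha>) c"
    unfolding A_def hyp_fps_quadratic[OF c] by simp
  then have *: "\<forall>\<^sub>F z in nhds 0. eval_fps (hyp_fps \<alpha> (2 * c - 1 - \<alpha>) c) z =
     (1 - 2 * z) powr (- \<alpha>) * eval_fps A (p z)"
    by (simp add: has_fps_expansion_def)
  have "\<forall>\<^sub>F z in nhds (0::complex). z \<in> - {1 / 2}"
    by (rule eventually_nhds_in_open) auto
  with * show ?thesis
  proof eventually_elim
    case (elim z)
    then have nz: "1 - 2 * z \<noteq> 0"
      by (auto simp: field_simps)
    then have "p z = - 4 * z * (1 - z) / (1 - 2 * z)\<^sup>2"
      using powr_of_int[OF nz, of "- 2"] by (simp add: p_def power_int_def divide_inverse power_inverse)
    with elim show ?case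
      by (simp only: A_def)
  qed
qed

section \<open>The generating function near the origin\<close>

text \<open>The quantity \<open>R\<close> of the theorem, extended from real to complex \<open>\<rho>\<close>.\<close>
definition gegen_dist :: "real \<Rightarrow> complex \<Rightarrow> complex" where
  "gegen_dist x \<rho> = csqrt (1 - 2 * of_real x * \<rho> + \<rho>\<^sup>2)"

text \<open>The argument \<open>(1 - y)/2\<close> of the hypergeometric function, where \<open>y = (1 - \<rho> x) / R\<close>.\<close>
definition gegen_arg :: "real \<Rightarrow> complex \<Rightarrow> complex" where
  "gegen_arg x \<rho> = (1 - (1 - of_real x * \<rho>) / gegen_dist x \<rho>) / 2"

text \<open>If the radicand is real, then \<open>\<rho>\<close> is real or has real part \<open>x\<close>. In the first case the radicand
  is \<open>(\<rho> - x)\<^sup>2 + 1 - x\<^sup>2\<close>, in the second it is \<open>1 - |\<rho>|\<^sup>2\<close>. Hence the principal square root is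
  holomorphic on the whole unit disc.\<close>
lemma gegen_dist_radicand:
  fixes \<rho> :: complex
  assumes "\<bar>x\<bar> \<le> 1" "norm \<rho> < 1"
  shows "1 - 2 * of_real x * \<rho> + \<rho>\<^sup>2 \<notin> \<real>\<^sub>\<le>\<^sub>0"
proof
  define a b where "a = Re \<rho>" and "b = Im \<rho>"
  assume "1 - 2 * of_real x * \<rho> + \<rho>\<^sup>2 \<in> \<real>\<^sub>\<le>\<^sub>0"
  then have le: "1 - 2 * x * a + a\<^sup>2 - b\<^sup>2 \<le> 0" and im: "2 * a * b - 2 * x * b = 0"
    by (auto simp: complex_nonpos_Reals_iff a_def b_def Re_power2 Im_power2)
  have ab: "a\<^sup>2 + b\<^sup>2 < 1"
    using assms(2) by (simp add: a_def b_def cmod_def)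
  have x2: "x\<^sup>2 \<le> 1"
    using assms(1) by (simp add: abs_square_le_1)
  from im have "b = 0 \<or> a = x"
    by (simp add: algebra_simps)
  then show False
  proof
    assume b: "b = 0"
    have "(a - x)\<^sup>2 + (1 - x\<^sup>2) \<le> 0"
      using le b by (simp add: power2_eq_square algebra_simps)
    then have "(a - x)\<^sup>2 = 0" "x\<^sup>2 = 1"
      using x2 zero_le_power2[of "a - x"] by linarith+
    then have "a = x" "x\<^sup>2 = 1"
      by auto
    then show False
      using ab b by simp
  next
    assume "a = x"
    then show False
      using le ab by (simp add: power2_eq_square)
  qed
qed

lemma Re_gegen_dist_pos:
  assumes "\<bar>x\<bar> \<le> 1" "norm \<rho> < 1"
  shows "Re (gegen_dist x \<rho>) > 0"
proof (rule ccontr)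
  assume "\<not> ?thesis"
  then have 0: "Re (gegen_dist x \<rho>) = 0"
    using csqrt_principal[of "1 - 2 * of_real x * \<rho> + \<rho>\<^sup>2"] by (simp add: gegen_dist_def)
  have "(gegen_dist x \<rho>)\<^sup>2 = 1 - 2 * of_real x * \<rho> + \<rho>\<^sup>2"
    by (simp add: gegen_dist_def)
  moreover have "(gegen_dist x \<rho>)\<^sup>2 \<in> \<real>\<^sub>\<le>\<^sub>0"
    using 0 by (simp add: complex_nonpos_Reals_iff Re_power2 Im_power2)
  ultimately show False
    using gegen_dist_radicand[OF assms] by simp
qed

lemma gegen_dist_holomorphic:
  assumes "\<bar>x\<bar> \<le> 1"
  shows "gegen_dist x holomorphic_on ball 0 1"
  unfolding gegen_dist_def [abs_def]
  by (intro holomorphic_intros) (use gegen_dist_radicand[OF assms] in auto)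

lemma gegen_arg_holomorphic:
  assumes "\<bar>x\<bar> \<le> 1"
  shows "gegen_arg x holomorphic_on ball 0 1"
  unfolding gegen_arg_def [abs_def]
  by (intro holomorphic_intros gegen_dist_holomorphic assms)
     (use Re_gegen_dist_pos[OF assms] in fastforce)+

lemma nonpos_Reals_if_Re_pos: "Re z > 0 \<Longrightarrow> z \<notin> \<real>\<^sub>\<le>\<^sub>0"
  by (auto simp: complex_nonpos_Reals_iff)

text \<open>In the right half-plane arguments are below \<open>\<pi>/2\<close> in modulus, so the principal logarithm is
  additive on products of two factors.\<close>
lemma powr_mult_Re_pos:
  assumes "Re u > 0" "Re v > 0"
  shows "(u * v) powr s = u powr s * v powr s"
proof -
  have "u \<noteq> 0" "v \<noteq> 0"
    using assms by auto
  moreover have "Ln (u * v) = Ln u + Ln v"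
    using Re_Ln_pos_lt_imp[OF assms(1)] Re_Ln_pos_lt_imp[OF assms(2)] calculation
    by (intro Ln_times_simple) auto
  ultimately show ?thesis
    by (simp add: powr_def exp_add algebra_simps)
qed

text \<open>Two functions with the same germ at \<open>\<rho> = 0\<close>: with \<open>R\<close> for \<open>gegen_dist x \<rho>\<close> and
  \<open>y = (1 - x \<rho>) / R\<close>, the quadratic transformation gives \<open>F(\<dots>; (1 - y)/2) = y\<^bsup>-\<alpha>\<^esup> F(\<dots>; 1 - 1/y\<^sup>2)\<close>.
  Here \<open>y R = 1 - x \<rho>\<close> and \<open>1 - 1/y\<^sup>2 = (x\<^sup>2 - 1) \<rho>\<^sup>2 / (1 - x \<rho>)\<^sup>2\<close>, which is the function
  expanded in \<open>gegen_sum_generating_function\<close>.\<close>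
lemma gegen_gf_expansion:
  fixes \<alpha> c :: complex
  assumes c: "\<And>n. c + of_nat n \<noteq> 0" and x: "\<bar>x\<bar> \<le> 1"
  shows "(\<lambda>\<rho>. gegen_dist x \<rho> powr (- \<alpha>) * eval_fps (hyp_fps \<alpha> (2 * c - 1 - \<alpha>) c) (gegen_arg x \<rho>))
           has_fps_expansion gegen_gf \<alpha> c (of_real x)"
proof -
  define A where "A = hyp_fps (\<alpha> / 2) ((\<alpha> + 1) / 2) c"
  define X where "X = complex_of_real x"
  define p where "p = (\<lambda>\<rho>. (X\<^sup>2 - 1) * \<rho>\<^sup>2 * (1 - X * \<rho>) powr (- 2))"
  have "p has_fps_expansion (fps_const (X\<^sup>2 - 1) * fps_X\<^sup>2 * binom_fps X 2)"
    unfolding p_def by (intro fps_expansion_intros powr_has_fps_expansion_binom_fps)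
  then have "(eval_fps A \<circ> p) has_fps_expansion (A oo (fps_const (X\<^sup>2 - 1) * fps_X\<^sup>2 * binom_fps X 2))"
    unfolding A_def by (intro has_fps_expansion_compose hyp_fps_has_expansion c) simp_all
  then have "(\<lambda>\<rho>. (1 - X * \<rho>) powr (- \<alpha>) * (eval_fps A \<circ> p) \<rho>) has_fps_expansion
      binom_fps X \<alpha> * (A oo (fps_const (X\<^sup>2 - 1) * fps_X\<^sup>2 * binom_fps X 2))"
    by (intro has_fps_expansion_mult powr_has_fps_expansion_binom_fps)
  then have exp: "(\<lambda>\<rho>. (1 - X * \<rho>) powr (- \<alpha>) * eval_fps A (p \<rho>)) has_fps_expansion gegen_gf \<alpha> c X"
    unfolding A_def gegen_sum_generating_function by simp
  have near: "\<forall>\<^sub>F \<rho> in nhds 0. \<rho> \<in> ball (0::complex) 1"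
    by (rule eventually_nhds_in_open) auto
  have cont: "isCont (gegen_arg x) 0" "isCont (\<lambda>\<rho>. (1 - X * \<rho>) / gegen_dist x \<rho>) 0"
  proof -
    show "isCont (gegen_arg x) 0"
      using holomorphic_on_imp_continuous_on[OF gegen_arg_holomorphic[OF x]]
      by (simp add: continuous_on_eq_continuous_at)
    have "isCont (gegen_dist x) 0"
      using holomorphic_on_imp_continuous_on[OF gegen_dist_holomorphic[OF x]]
      by (simp add: continuous_on_eq_continuous_at)
    then show "isCont (\<lambda>\<rho>. (1 - X * \<rho>) / gegen_dist x \<rho>) 0"
      by (intro continuous_intros) (simp_all add: gegen_dist_def)
  qed
  have "gegen_arg x 0 = 0"
    by (simp add: gegen_arg_def gegen_dist_def)
  then have "filterlim (gegen_arg x) (nhds 0) (nhds 0)"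
    using cont(1) by (simp add: isCont_def tendsto_nhds_iff)
  then have quad: "\<forall>\<^sub>F \<rho> in nhds 0. eval_fps (hyp_fps \<alpha> (2 * c - 1 - \<alpha>) c) (gegen_arg x \<rho>) =
     (1 - 2 * gegen_arg x \<rho>) powr (- \<alpha>) *
       eval_fps A (- 4 * gegen_arg x \<rho> * (1 - gegen_arg x \<rho>) / (1 - 2 * gegen_arg x \<rho>)\<^sup>2)"
    using hyp_fps_quadratic_near_0[OF c, of \<alpha>] unfolding A_def by (rule eventually_compose_filterlim[rotated])
  have "((\<lambda>\<rho>. Re ((1 - X * \<rho>) / gegen_dist x \<rho>)) \<longlongrightarrow> Re ((1 - X * 0) / gegen_dist x 0)) (nhds 0)"
    using tendsto_Re[OF cont(2)[unfolded isCont_def]] by (simp add: tendsto_nhds_iff)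
  then have pos: "\<forall>\<^sub>F \<rho> in nhds 0. 0 < Re ((1 - X * \<rho>) / gegen_dist x \<rho>)"
    by (rule order_tendstoD) (simp add: gegen_dist_def)
  have "\<forall>\<^sub>F \<rho> in nhds 0. gegen_dist x \<rho> powr (- \<alpha>) * eval_fps (hyp_fps \<alpha> (2 * c - 1 - \<alpha>) c) (gegen_arg x \<rho>)
     = (1 - X * \<rho>) powr (- \<alpha>) * eval_fps A (p \<rho>)"
    using near quad pos
  proof eventually_elim
    case (elim \<rho>)
    define S y where "S = gegen_dist x \<rho>" and "y = (1 - X * \<rho>) / S"
    have S: "Re S > 0"
      using Re_gegen_dist_pos[OF x] elim by (simp add: S_def)
    then have Snz: "S \<noteq> 0"
      by auto
    have y: "Re y > 0"
      using elim by (simp add: y_def S_def)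
    have ynz: "y \<noteq> 0"
      using y by auto
    have yS: "y * S = 1 - X * \<rho>"
      using Snz by (simp add: y_def)
    then have nz: "1 - X * \<rho> \<noteq> 0"
      using Snz ynz by (metis mult_eq_0_iff)
    have S2: "S\<^sup>2 = 1 - 2 * X * \<rho> + \<rho>\<^sup>2"
      by (simp add: S_def gegen_dist_def X_def)
    have arg: "gegen_arg x \<rho> = (1 - y) / 2"
      by (simp add: gegen_arg_def y_def S_def X_def)
    have "- 4 * gegen_arg x \<rho> * (1 - gegen_arg x \<rho>) = y\<^sup>2 - 1"
      by (simp add: arg power2_eq_square field_simps)
    moreover have "1 - 2 * gegen_arg x \<rho> = y"
      by (simp add: arg field_simps)
    ultimately have "- 4 * gegen_arg x \<rho> * (1 - gegen_arg x \<rho>) / (1 - 2 * gegen_arg x \<rho>)\<^sup>2 = (y\<^sup>2 - 1) / y\<^sup>2"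
      by simp
    also have "\<dots> = ((y * S)\<^sup>2 - S\<^sup>2) / (y * S)\<^sup>2"
      using Snz ynz by (simp add: field_simps)
    also have "\<dots> = (X\<^sup>2 - 1) * \<rho>\<^sup>2 / (1 - X * \<rho>)\<^sup>2"
      unfolding yS S2 by (simp add: power2_eq_square algebra_simps)
    also have "\<dots> = p \<rho>"
      using powr_of_int[OF nz, of "- 2"] by (simp add: p_def power_int_def divide_inverse power_inverse)
    finally have w: "- 4 * gegen_arg x \<rho> * (1 - gegen_arg x \<rho>) / (1 - 2 * gegen_arg x \<rho>)\<^sup>2 = p \<rho>" .
    have "1 - 2 * gegen_arg x \<rho> = y"
      by (simp add: arg field_simps)
    with elim(2) w have "eval_fps (hyp_fps \<alpha> (2 * c - 1 - \<alpha>) c) (gegen_arg x \<rho>) =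
        y powr (- \<alpha>) * eval_fps A (p \<rho>)"
      by simp
    moreover have "(1 - X * \<rho>) powr (- \<alpha>) = y powr (- \<alpha>) * S powr (- \<alpha>)"
      unfolding yS[symmetric] using y S by (rule powr_mult_Re_pos)
    ultimately show ?case
      by (simp add: S_def)
  qed
  with exp show ?thesis
    unfolding X_def by (subst has_fps_expansion_cong[OF _ refl])
qed

section \<open>Extension to the unit interval\<close>

lemma hyp2f1_series_eq_eval_fps: "hyp2f1_series a b c z = eval_fps (hyp_fps a b c) z"
  by (simp add: hyp2f1_series_def eval_fps_def hyp_fps_nth)

text \<open>Includes the point \<open>1\<close>, where the argument of the Gegenbauer polynomial sits for \<open>x = -1\<close> and
  where \<open>hyp2f1\<close> is defined by the series.\<close>
lemma hyp2f1_unit_interval: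
  assumes "0 \<le> t" "t \<le> 1"
  shows "hyp2f1 a b c (of_real t) = eval_fps (hyp_fps a b c) (of_real t)"
proof -
  have "norm (complex_of_real t) < 1 \<or> complex_of_real t \<in> complex_of_real ` {1..}"
    using assms by (cases "t = 1") auto
  then show ?thesis
    by (simp only: hyp2f1_def hyp2f1_series_eq_eval_fps if_True)
qed

lemma gegenbauer_eq_gegen_sum:
  fixes \<mu> x :: real
  assumes "\<mu> > - 1/2" "\<bar>x\<bar> \<le> 1"
  shows "gegenbauer n (of_real \<mu>) (of_real x) =
    pochhammer (2 * of_real \<mu>) n / fact n * gegen_sum (of_real (\<mu> + 1/2)) n (of_real x)"
proof -
  have c: "complex_of_real (\<mu> + 1/2) + of_nat k \<noteq> 0" for k
  proof -
    have "\<mu> + 1/2 + real k \<noteq> 0"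
      using assms by linarith
    then have "complex_of_real (\<mu> + 1/2 + real k) \<noteq> 0"
      by (simp only: of_real_eq_0_iff not_False_eq_True)
    then show ?thesis by simp
  qed
  have "(1 - complex_of_real x) / 2 = of_real ((1 - x) / 2)"
    by simp
  then have "hyp2f1 (- of_nat n) (of_nat n + 2 * of_real \<mu>) (of_real \<mu> + 1/2) ((1 - of_real x) / 2)
     = eval_fps (hyp_fps (- of_nat n) (of_nat n + 2 * of_real \<mu>) (of_real \<mu> + 1/2)) ((1 - of_real x) / 2)"
    using hyp2f1_unit_interval[of "(1 - x) / 2"] assms by simp
  moreover have "of_nat n + 2 * of_real \<mu> = 2 * of_real (\<mu> + 1/2) - 1 + (of_nat n :: complex)"
    by simp
  moreover have "of_real \<mu> + 1/2 = complex_of_real (\<mu> + 1/2)"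
    by simp
  ultimately show ?thesis
    unfolding gegenbauer_def by (simp only: eval_hyp_fps_terminating[OF c])
qed

text \<open>For \<open>r < s < 1\<close> the numbers \<open>f n * s ^ n\<close> are bounded, while \<open>(a)\<^sub>n / (b)\<^sub>n (r/s)\<^sup>n\<close> is the general
  term of \<open>F(a, 1; b; r/s)\<close>, which converges absolutely.\<close>
lemma conv_radius_hadamard_hyp:
  fixes f :: "nat \<Rightarrow> complex" and a b :: complex
  assumes b: "\<And>n. b + of_nat n \<noteq> 0" and f: "conv_radius f \<ge> 1"
  shows "conv_radius (\<lambda>n. pochhammer a n / pochhammer b n * f n) \<ge> 1"
proof (rule conv_radius_geI_ex')
  fix r :: real assume r: "0 < r" "ereal r < 1"
  then have "r < 1"
    by simp
  then obtain s where s: "r < s" "s < 1"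
    using dense by blast
  with r have "0 < s"
    by simp
  have "ereal (norm (complex_of_real s)) < 1"
    using s \<open>0 < s\<close> by simp
  also note f
  finally have "summable (\<lambda>n. f n * of_real s ^ n)"
    by (rule summable_in_conv_radius)
  then have "bounded (range (\<lambda>n. f n * of_real s ^ n))"
    by (intro convergent_imp_bounded) (blast intro: summable_LIMSEQ_zero)
  then obtain C where C: "\<And>n. norm (f n * of_real s ^ n) \<le> C"
    by (auto simp: bounded_iff)
  define h where "h = (\<lambda>n. pochhammer a n / pochhammer b n * complex_of_real (r / s) ^ n)"
  have "norm (complex_of_real (r / s)) < 1"
    unfolding norm_of_real using r s \<open>0 < s\<close> by simp
  then have "summable (\<lambda>n. norm (hyp_fps a 1 b $ n * of_real (r / s) ^ n))"
    using norm_summable_fps[OF norm_less_conv_radius_hyp_fps[OF b]] by blast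
  moreover have "hyp_fps a 1 b $ n * of_real (r / s) ^ n = h n" for n
    by (simp add: hyp_fps_nth h_def pochhammer_fact[symmetric])
  ultimately have "summable (\<lambda>n. norm (h n))"
    by simp
  then have *: "summable (\<lambda>n. C * norm (h n))"
    by (rule summable_mult)
  show "summable (\<lambda>n. pochhammer a n / pochhammer b n * f n * of_real r ^ n)"
  proof (rule summable_comparison_test'[OF *])
    fix n
    have "(complex_of_real r) ^ n = of_real (r / s) ^ n * of_real s ^ n"
      using \<open>0 < s\<close> by (simp add: power_divide)
    then have "pochhammer a n / pochhammer b n * f n * of_real r ^ n = (f n * of_real s ^ n) * h n"
      by (simp only: h_def mult_ac)
    then show "norm (pochhammer a n / pochhammer b n * f n * of_real r ^ n) \<le> C * norm (h n)"
      using C[of n] by (simp only: norm_mult[of "f n * of_real s ^ n"] mult_right_mono norm_ge_zero)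
  qed
qed

text \<open>The growth of the polynomials on \<open>[-1, 1]\<close> is read off from one function: at \<open>\<alpha> = 2c - 1\<close> the
  hypergeometric factor is \<open>1\<close>, and \<open>R\<^bsup>-\<alpha>\<^esup>\<close> has no singularity in the open unit disc. Other
  values of \<open>\<alpha>\<close> change the coefficients by the factor \<open>(\<alpha>)\<^sub>n / (2c - 1)\<^sub>n\<close> only.\<close>
lemma fps_conv_radius_gegen_gf:
  fixes \<alpha> c :: complex
  assumes c: "\<And>n. c + of_nat n \<noteq> 0" and c': "\<And>n. 2 * c - 1 + of_nat n \<noteq> 0" and x: "\<bar>x\<bar> \<le> 1"
  shows "fps_conv_radius (gegen_gf \<alpha> c (of_real x)) \<ge> 1"
proof -
  define \<beta> where "\<beta> = 2 * c - 1"
  have "hyp_fps \<beta> 0 c = 1"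
    by (rule fps_ext) (simp add: hyp_fps_nth pochhammer_0_left)
  then have "(\<lambda>\<rho>. gegen_dist x \<rho> powr (- \<beta>)) has_fps_expansion gegen_gf \<beta> c (of_real x)"
    using gegen_gf_expansion[OF c x, of \<beta>] by (simp add: \<beta>_def)
  moreover have "(\<lambda>\<rho>. gegen_dist x \<rho> powr (- \<beta>)) holomorphic_on eball 0 1"
    unfolding one_ereal_def eball_ereal
    by (intro holomorphic_intros gegen_dist_holomorphic x nonpos_Reals_if_Re_pos Re_gegen_dist_pos) auto
  ultimately have "conv_radius (fps_nth (gegen_gf \<beta> c (of_real x))) \<ge> 1"
    unfolding fps_conv_radius_def[symmetric] by (rule holomorphic_on_imp_fps_conv_radius_ge)
  then have "conv_radius (\<lambda>n. pochhammer \<alpha> n / pochhammer \<beta> n * gegen_gf \<beta> c (of_real x) $ n) \<ge> 1"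
    using c' by (intro conv_radius_hadamard_hyp) (auto simp: \<beta>_def)
  moreover have "pochhammer \<alpha> n / pochhammer \<beta> n * gegen_gf \<beta> c (of_real x) $ n = gegen_gf \<alpha> c (of_real x) $ n" for n
  proof -
    have "pochhammer \<beta> n \<noteq> 0"
      using c' by (auto simp: pochhammer_eq_0_iff \<beta>_def eq_neg_iff_add_eq_0)
    then show ?thesis
      by (simp add: gegen_gf_def)
  qed
  ultimately show ?thesis
    by (simp add: fps_conv_radius_def)
qed

text \<open>For real \<open>\<rho>\<close> the radicand is \<open>(1 - \<rho> x)\<^sup>2 + \<rho>\<^sup>2 (1 - x\<^sup>2)\<close>, whence \<open>0 < y \<le> 1\<close>.\<close>
lemma gegen_dist_of_real:
  assumes "\<bar>x\<bar> \<le> 1" "0 \<le> \<rho>" "\<rho> < 1"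
  defines "R \<equiv> sqrt (1 + \<rho>\<^sup>2 - 2 * \<rho> * x)"
  shows "gegen_dist x (of_real \<rho>) = of_real R" "R > 0"
    "(1 - \<rho> * x) / R > 0" "(1 - \<rho> * x) / R \<le> 1"
    "gegen_arg x (of_real \<rho>) = of_real ((1 - (1 - \<rho> * x) / R) / 2)"
    "norm (gegen_arg x (of_real \<rho>)) < 1"
proof -
  have "\<rho> * x \<le> \<rho> * 1"
    using assms by (intro mult_left_mono) auto
  then have lin: "1 - \<rho> * x > 0"
    using assms by simp
  have x2: "x\<^sup>2 \<le> 1"
    using assms(1) by (simp add: abs_square_le_1)
  have "1 + \<rho>\<^sup>2 - 2 * \<rho> * x = (1 - \<rho> * x)\<^sup>2 + \<rho>\<^sup>2 * (1 - x\<^sup>2)"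
    by (simp add: power2_eq_square algebra_simps)
  moreover have "\<rho>\<^sup>2 * (1 - x\<^sup>2) \<ge> 0"
    using x2 by simp
  moreover have "(1 - \<rho> * x)\<^sup>2 > 0"
    using lin by simp
  ultimately have T: "1 + \<rho>\<^sup>2 - 2 * \<rho> * x \<ge> (1 - \<rho> * x)\<^sup>2" "1 + \<rho>\<^sup>2 - 2 * \<rho> * x > 0"
    by linarith+
  show R: "R > 0"
    using T by (simp add: R_def)
  show y: "(1 - \<rho> * x) / R > 0"
    using lin R by simp
  show y1: "(1 - \<rho> * x) / R \<le> 1"
    using T R by (simp add: R_def real_le_rsqrt)
  have "1 - 2 * of_real x * of_real \<rho> + (of_real \<rho>)\<^sup>2 = complex_of_real (1 + \<rho>\<^sup>2 - 2 * \<rho> * x)"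
    by simp
  then show dist: "gegen_dist x (of_real \<rho>) = of_real R"
    unfolding gegen_dist_def R_def using T(2) by (simp only: of_real_sqrt less_imp_le)
  show arg: "gegen_arg x (of_real \<rho>) = of_real ((1 - (1 - \<rho> * x) / R) / 2)"
    unfolding gegen_arg_def dist by (simp add: mult.commute)
  show "norm (gegen_arg x (of_real \<rho>)) < 1"
    unfolding arg norm_of_real using y y1 by simp
qed

text \<open>Both sides are holomorphic where \<open>|\<rho>| < 1\<close> and the argument \<open>(1 - y)/2\<close> lies in the unit disc.
  This set need not be the whole unit disc, since \<open>y\<close> is unbounded near the zeros of \<open>R\<close>, which lie
  on the unit circle if \<open>|x| < 1\<close>. It contains \<open>[0, 1)\<close>, so the identity theorem is applied to its component of \<open>0\<close>.\<close>
theorem gegen_gf_sums: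
  fixes \<alpha> c :: complex
  assumes c: "\<And>n. c + of_nat n \<noteq> 0" and c': "\<And>n. 2 * c - 1 + of_nat n \<noteq> 0"
    and x: "\<bar>x\<bar> \<le> 1" and \<rho>: "0 \<le> \<rho>" "\<rho> < 1"
  shows "(\<lambda>n. gegen_gf \<alpha> c (of_real x) $ n * of_real \<rho> ^ n) sums
    (gegen_dist x (of_real \<rho>) powr (- \<alpha>) * eval_fps (hyp_fps \<alpha> (2 * c - 1 - \<alpha>) c) (gegen_arg x (of_real \<rho>)))"
proof -
  define H where "H = (\<lambda>\<rho>. gegen_dist x \<rho> powr (- \<alpha>) * eval_fps (hyp_fps \<alpha> (2 * c - 1 - \<alpha>) c) (gegen_arg x \<rho>))"
  define F where "F = gegen_gf \<alpha> c (of_real x)"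
  have rad: "ereal (norm z) < fps_conv_radius F" if "norm z < 1" for z :: complex
  proof -
    have "ereal (norm z) < 1"
      using that by simp
    also note fps_conv_radius_gegen_gf[OF c c' x, of \<alpha>]
    finally show ?thesis
      by (simp add: F_def)
  qed
  define S where "S = ball 0 1 \<inter> gegen_arg x -` ball 0 1"
  have "open S"
    unfolding S_def
    by (intro continuous_open_preimage holomorphic_on_imp_continuous_on gegen_arg_holomorphic x) auto
  define C where "C = connected_component_set S 0"
  have C: "open C" "connected C" "C \<subseteq> S"
    using \<open>open S\<close> by (auto simp: C_def open_connected_component connected_component_subset)
  have seg: "of_real ` {0..<1} \<subseteq> S"
    using gegen_dist_of_real(6)[OF x] by (auto simp: S_def)
  have "connected (complex_of_real ` {0..<1})"
    by (intro connected_continuous_image continuous_intros) auto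
  then have segC: "complex_of_real ` {0..<1} \<subseteq> C"
    unfolding C_def using seg by (intro connected_component_maximal) (auto intro!: image_eqI[of _ _ 0])
  have H_hol: "H holomorphic_on C"
    unfolding H_def
  proof (intro holomorphic_intros nonpos_Reals_if_Re_pos Re_gegen_dist_pos x)
    show "gegen_dist x holomorphic_on C"
      using gegen_dist_holomorphic[OF x] by (rule holomorphic_on_subset) (use C in \<open>auto simp: S_def\<close>)
    have "gegen_arg x holomorphic_on C"
      using gegen_arg_holomorphic[OF x] by (rule holomorphic_on_subset) (use C in \<open>auto simp: S_def\<close>)
    moreover have "eval_fps (hyp_fps \<alpha> (2 * c - 1 - \<alpha>) c) holomorphic_on ball 0 1"
      by (intro holomorphic_on_eval_fps) (auto intro!: norm_less_conv_radius_hyp_fps c)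
    ultimately show "(\<lambda>\<rho>. eval_fps (hyp_fps \<alpha> (2 * c - 1 - \<alpha>) c) (gegen_arg x \<rho>)) holomorphic_on C"
      using holomorphic_on_compose_gen[of "gegen_arg x" C "eval_fps (hyp_fps \<alpha> (2 * c - 1 - \<alpha>) c)" "ball 0 1"] C
      by (auto simp: o_def S_def)
  qed (use C in \<open>auto simp: S_def\<close>)
  have F_hol: "eval_fps F holomorphic_on C"
    by (intro holomorphic_on_eval_fps) (use C rad in \<open>auto simp: S_def\<close>)
  have "H has_fps_expansion F"
    unfolding H_def F_def by (rule gegen_gf_expansion[OF c x])
  then have "\<forall>\<^sub>F z in nhds 0. eval_fps F z = H z"
    by (simp add: has_fps_expansion_def)
  then obtain U where U: "open U" "0 \<in> U" "\<And>z. z \<in> U \<Longrightarrow> H z = eval_fps F z"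
    unfolding eventually_nhds by metis
  have "complex_of_real 0 \<in> C"
    using segC by (auto simp: image_subset_iff simp del: of_real_0)
  then have "0 \<in> C"
    by simp
  have "H (of_real \<rho>) = eval_fps F (of_real \<rho>)"
  proof (rule analytic_continuation_open[where s = "U \<inter> C" and s' = C and f = H and g = "eval_fps F"])
    show "U \<inter> C \<noteq> {}"
      using \<open>0 \<in> C\<close> U by auto
    show "of_real \<rho> \<in> C"
      using segC \<rho> by (auto simp: image_subset_iff)
  qed (use U C H_hol F_hol in auto)
  moreover have "(\<lambda>n. F $ n * of_real \<rho> ^ n) sums eval_fps F (of_real \<rho>)"
    using rad[of "of_real \<rho>"] \<rho> by (intro sums_eval_fps) simp
  ultimately show ?thesis
    by (simp add: F_def H_def)
qed

section \<open>The Ferrers function and the theorem\<close>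

text \<open>With \<open>e = \<mu>/2 - 1/4\<close> every factor becomes a power with exponent \<open>e\<close>: the bases with exponent \<open>-e\<close>
  are inverted, those with exponent \<open>2e\<close> squared. The four new bases multiply to \<open>(\<rho>/2)\<^sup>2\<close>.\<close>
lemma powr_prefactor:
  fixes \<mu> \<rho> t R y :: real
  assumes \<rho>: "0 < \<rho>" and t: "\<bar>t\<bar> < 1" and R: "0 < R" and y: "0 < y" "y < 1"
    and yR: "(1 - y\<^sup>2) * R\<^sup>2 = \<rho>\<^sup>2 * (1 - t\<^sup>2)"
  shows "(1 - t\<^sup>2) powr (1/4 - \<mu>/2) * R powr (\<mu> - 1/2) * ((1 + y) / (1 - y)) powr ((1/2 - \<mu>) / 2)
     * ((1 + y) / 2) powr (\<mu> - 1/2) = (\<rho> / 2) powr (\<mu> - 1/2)"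
proof -
  define e where "e = \<mu>/2 - 1/4"
  have sq: "u powr (\<mu> - 1/2) = (u\<^sup>2) powr e" if "u > 0" for u
  proof -
    have "(u\<^sup>2) powr e = (u powr 2) powr e"
      using that by simp
    also have "\<dots> = u powr (\<mu> - 1/2)"
      unfolding powr_powr by (simp add: e_def)
    finally show ?thesis by simp
  qed
  have inv: "u powr (- e) = (inverse u) powr e" if "u > 0" for u :: real
    using that by (simp add: powr_def ln_inverse)
  have t2: "1 - t\<^sup>2 > 0"
    using t by (simp add: abs_square_less_1)
  have y2: "(1 + y) / (1 - y) > 0" "(1 + y) / 2 > 0"
    using y by auto
  have "inverse (1 - t\<^sup>2) * R\<^sup>2 * inverse ((1 + y) / (1 - y)) * ((1 + y) / 2)\<^sup>2
      = (1 - y\<^sup>2) * R\<^sup>2 / (4 * (1 - t\<^sup>2))"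
    using y t2 by (simp add: power2_eq_square divide_simps) (simp add: algebra_simps)
  also have "\<dots> = (\<rho> / 2)\<^sup>2"
  proof -
    have "\<rho>\<^sup>2 * u / (4 * u) = (\<rho> / 2)\<^sup>2" if "u > 0" for u
      using that by (simp add: power_divide)
    from this[OF t2] show ?thesis
      by (simp only: yR)
  qed
  finally have base: "inverse (1 - t\<^sup>2) * R\<^sup>2 * inverse ((1 + y) / (1 - y)) * ((1 + y) / 2)\<^sup>2 = (\<rho> / 2)\<^sup>2" .
  have "1/4 - \<mu>/2 = - e" "(1/2 - \<mu>) / 2 = - e"
    by (simp_all add: e_def field_simps)
  then have "(1 - t\<^sup>2) powr (1/4 - \<mu>/2) * R powr (\<mu> - 1/2) * ((1 + y) / (1 - y)) powr ((1/2 - \<mu>) / 2)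
     * ((1 + y) / 2) powr (\<mu> - 1/2)
     = (inverse (1 - t\<^sup>2) * R\<^sup>2 * inverse ((1 + y) / (1 - y)) * ((1 + y) / 2)\<^sup>2) powr e"
    by (simp only: sq[OF R] sq[OF y2(2)] inv[OF t2] inv[OF y2(1)] powr_mult)
  also have "\<dots> = (\<rho> / 2) powr (\<mu> - 1/2)"
    unfolding base using \<rho> by (simp add: sq)
  finally show ?thesis .
qed

text \<open>Euler's transformation replaces the parameters \<open>\<alpha> + 1/2 - \<mu>\<close> and \<open>\<mu> - \<alpha> + 1/2\<close> of the Ferrers
  function by \<open>2\<mu> - \<alpha>\<close> and \<open>\<alpha>\<close>, at the cost of the factor \<open>((1 + y)/2)\<^bsup>\<mu> - 1/2\<^esup>\<close> that
  \<open>powr_prefactor\<close> absorbs. The hypothesis \<open>|t| < 1\<close> keeps \<open>y < 1\<close>, where the Ferrers function is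
  regular.\<close>
lemma ferrers_P_eq_hyp_fps:
  fixes \<alpha> :: complex and \<mu> \<rho> t :: real
  assumes \<mu>: "\<mu> > - 1/2" and \<rho>: "0 < \<rho>" "\<rho> < 1" and t: "\<bar>t\<bar> < 1"
  defines "R \<equiv> sqrt (1 + \<rho>\<^sup>2 - 2 * \<rho> * t)" and "c \<equiv> complex_of_real (\<mu> + 1/2)"
  shows "of_real ((1 - t\<^sup>2) powr (1/4 - \<mu>/2)) / of_real R powr (1/2 + \<alpha> - of_real \<mu>)
      * ferrers_P (of_real \<mu> - \<alpha> - 1/2) (of_real (1/2 - \<mu>)) ((1 - \<rho> * t) / R)
    = of_real ((\<rho>/2) powr (\<mu> - 1/2) / Gamma (\<mu> + 1/2))
      * (of_real R powr (- \<alpha>)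
          * eval_fps (hyp_fps \<alpha> (2 * c - 1 - \<alpha>) c) (of_real ((1 - (1 - \<rho> * t) / R) / 2)))"
proof -
  define y where "y = (1 - \<rho> * t) / R"
  define z where "z = (1 - y) / 2"
  have R: "R > 0" and y: "0 < y" "y \<le> 1"
    using gegen_dist_of_real(2-4)[of t \<rho>] t \<rho> by (auto simp: R_def y_def)
  have c: "c + of_nat n \<noteq> 0" for n
  proof -
    have "\<mu> + 1/2 + real n \<noteq> 0"
      using \<mu> by linarith
    then have "complex_of_real (\<mu> + 1/2 + real n) \<noteq> 0"
      by (simp only: of_real_eq_0_iff not_False_eq_True)
    then show ?thesis by (simp add: c_def)
  qed
  have "0 \<le> 1 + \<rho>\<^sup>2 - 2 * \<rho> * t"
    using R unfolding R_def by (metis less_imp_le real_sqrt_gt_0_iff)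
  then have R2: "R\<^sup>2 = 1 + \<rho>\<^sup>2 - 2 * \<rho> * t"
    by (simp add: R_def)
  have "(1 - y\<^sup>2) * R\<^sup>2 = R\<^sup>2 - (y * R)\<^sup>2"
    by (simp add: power2_eq_square algebra_simps)
  also have "y * R = 1 - \<rho> * t"
    using R by (simp add: y_def)
  also have "R\<^sup>2 - (1 - \<rho> * t)\<^sup>2 = \<rho>\<^sup>2 * (1 - t\<^sup>2)"
    unfolding R2 by (simp add: power2_eq_square algebra_simps)
  finally have yR: "(1 - y\<^sup>2) * R\<^sup>2 = \<rho>\<^sup>2 * (1 - t\<^sup>2)" .
  moreover have "\<rho>\<^sup>2 * (1 - t\<^sup>2) > 0"
    using \<rho> t by (simp add: abs_square_less_1)
  ultimately have "y \<noteq> 1"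
    by auto
  with y have y1: "y < 1"
    by simp
  have z: "0 \<le> z" "z \<le> 1" "norm (complex_of_real z) < 1"
    unfolding norm_of_real using y by (auto simp: z_def)
  define a b where "a = \<alpha> + 1/2 - of_real \<mu>" and "b = of_real \<mu> - \<alpha> + 1/2"
  have "c - a - b = of_real (\<mu> - 1/2)" "c - a = 2 * c - 1 - \<alpha>" "c - b = \<alpha>"
    by (simp_all add: a_def b_def c_def algebra_simps)
  then have "eval_fps (hyp_fps a b c) (of_real z)
      = (1 - of_real z) powr of_real (\<mu> - 1/2) * eval_fps (hyp_fps \<alpha> (2 * c - 1 - \<alpha>) c) (of_real z)"
    using eval_hyp_fps_euler[OF c z(3), of a b] by (simp only: hyp_fps_commute[of "2 * c - 1 - \<alpha>"])
  moreover have "1 - complex_of_real z = of_real ((1 + y) / 2)"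
    by (simp add: z_def field_simps)
  ultimately have hyp: "hyp2f1 a b c (of_real z)
      = of_real (((1 + y) / 2) powr (\<mu> - 1/2)) * eval_fps (hyp_fps \<alpha> (2 * c - 1 - \<alpha>) c) (of_real z)"
    using y z by (simp only: hyp2f1_unit_interval) (simp add: powr_of_real[symmetric])
  have "1 - complex_of_real (1/2 - \<mu>) = c" "- (of_real \<mu> - \<alpha> - 1/2) = a"
    "of_real \<mu> - \<alpha> - 1/2 + 1 = b" "complex_of_real (1/2 - \<mu>) / 2 = of_real ((1/2 - \<mu>) / 2)"
    by (simp_all add: a_def b_def c_def)
  then have "ferrers_P (of_real \<mu> - \<alpha> - 1/2) (of_real (1/2 - \<mu>)) y
      = 1 / Gamma c * of_real ((1 + y) / (1 - y)) powr of_real ((1/2 - \<mu>) / 2) * hyp2f1 a b c (of_real z)"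
    unfolding ferrers_P_def z_def by (simp only:)
  also have "Gamma c = of_real (Gamma (\<mu> + 1/2))"
    unfolding c_def by (rule Gamma_complex_of_real)
  also have "of_real ((1 + y) / (1 - y)) powr complex_of_real ((1/2 - \<mu>) / 2)
      = of_real (((1 + y) / (1 - y)) powr ((1/2 - \<mu>) / 2))"
    using y y1 by (intro powr_of_real) simp
  finally have ferrers: "ferrers_P (of_real \<mu> - \<alpha> - 1/2) (of_real (1/2 - \<mu>)) y
      = 1 / of_real (Gamma (\<mu> + 1/2)) * of_real (((1 + y) / (1 - y)) powr ((1/2 - \<mu>) / 2))
        * (of_real (((1 + y) / 2) powr (\<mu> - 1/2)) * eval_fps (hyp_fps \<alpha> (2 * c - 1 - \<alpha>) c) (of_real z))"
    unfolding hyp .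
  have "1/2 + \<alpha> - of_real \<mu> = - (- \<alpha> + of_real (\<mu> - 1/2))"
    by simp
  then have "1 / of_real R powr (1/2 + \<alpha> - of_real \<mu>) = of_real R powr (- \<alpha> + of_real (\<mu> - 1/2))"
    by (simp only: powr_minus_divide) simp
  also have "\<dots> = of_real R powr (- \<alpha>) * of_real (R powr (\<mu> - 1/2))"
    using R by (simp only: powr_add powr_of_real less_imp_le)
  finally have Rp: "1 / of_real R powr (1/2 + \<alpha> - of_real \<mu>) = of_real R powr (- \<alpha>) * of_real (R powr (\<mu> - 1/2))" .
  define E where "E = eval_fps (hyp_fps \<alpha> (2 * c - 1 - \<alpha>) c) (of_real z)"
  have "of_real ((1 - t\<^sup>2) powr (1/4 - \<mu>/2)) / of_real R powr (1/2 + \<alpha> - of_real \<mu>)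
      * ferrers_P (of_real \<mu> - \<alpha> - 1/2) (of_real (1/2 - \<mu>)) y
     = of_real ((1 - t\<^sup>2) powr (1/4 - \<mu>/2)) * (1 / of_real R powr (1/2 + \<alpha> - of_real \<mu>))
      * ferrers_P (of_real \<mu> - \<alpha> - 1/2) (of_real (1/2 - \<mu>)) y"
    by simp
  also have "\<dots> = of_real ((1 - t\<^sup>2) powr (1/4 - \<mu>/2) * R powr (\<mu> - 1/2)
       * ((1 + y) / (1 - y)) powr ((1/2 - \<mu>) / 2) * ((1 + y) / 2) powr (\<mu> - 1/2) / Gamma (\<mu> + 1/2))
      * (of_real R powr (- \<alpha>) * E)"
    unfolding Rp ferrers E_def[symmetric] of_real_mult of_real_divide by (simp add: mult_ac)
  also have "\<dots> = of_real ((\<rho>/2) powr (\<mu> - 1/2) / Gamma (\<mu> + 1/2)) * (of_real R powr (- \<alpha>) * E)"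
    unfolding powr_prefactor[OF \<rho>(1) t R y(1) y1 yR] ..
  finally show ?thesis
    by (simp only: y_def z_def E_def)
qed

theorem theorem3:
  fixes \<alpha> :: complex and \<mu> \<rho> x :: real
  assumes "\<mu> > - 1/2" and "\<mu> \<noteq> 0" and "0 < \<rho>" and "\<rho> < 1" and "x \<in> {-1..1}"
  shows
    "let R = (\<lambda>t::real. sqrt (1 + \<rho>\<^sup>2 - 2 * \<rho> * t));
         lhs = (\<lambda>t::real.
           complex_of_real ((1 - t\<^sup>2) powr (1/4 - \<mu>/2))
             / complex_of_real (R t) powr (1/2 + \<alpha> - complex_of_real \<mu>)
           * ferrers_P (complex_of_real \<mu> - \<alpha> - 1/2) (complex_of_real (1/2 - \<mu>)) ((1 - \<rho> * t) / R t));
         term = (\<lambda>n. pochhammer \<alpha> n / pochhammer (complex_of_real (2 * \<mu>)) n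
                       * complex_of_real \<rho> ^ n
                       * gegenbauer n (complex_of_real \<mu>) (complex_of_real x));
         rhs = complex_of_real ((\<rho>/2) powr (\<mu> - 1/2) / Gamma (\<mu> + 1/2)) * (\<Sum>n. term n)
     in summable term
        \<and> (x \<in> {-1<..<1} \<longrightarrow> lhs x = rhs)
        \<and> (x \<in> {-1, 1} \<longrightarrow> (lhs \<longlongrightarrow> rhs) (at x within {-1<..<1}))"
proof -
  define c where "c = complex_of_real (\<mu> + 1/2)"
  define K where "K = complex_of_real ((\<rho>/2) powr (\<mu> - 1/2) / Gamma (\<mu> + 1/2))"
  define R where "R = (\<lambda>t::real. sqrt (1 + \<rho>\<^sup>2 - 2 * \<rho> * t))"
  define lhs where "lhs = (\<lambda>t::real. complex_of_real ((1 - t\<^sup>2) powr (1/4 - \<mu>/2))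
             / complex_of_real (R t) powr (1/2 + \<alpha> - complex_of_real \<mu>)
           * ferrers_P (complex_of_real \<mu> - \<alpha> - 1/2) (complex_of_real (1/2 - \<mu>)) ((1 - \<rho> * t) / R t))"
  define trm where "trm = (\<lambda>n. pochhammer \<alpha> n / pochhammer (complex_of_real (2 * \<mu>)) n
                       * complex_of_real \<rho> ^ n
                       * gegenbauer n (complex_of_real \<mu>) (complex_of_real x))"
  define z where "z = (\<lambda>t. (1 - (1 - \<rho> * t) / R t) / 2)"
  define F where "F = eval_fps (hyp_fps \<alpha> (2 * c - 1 - \<alpha>) c)"
  define G where "G = (\<lambda>t. complex_of_real (R t) powr (- \<alpha>) * F (of_real (z t)))"
  have x: "\<bar>x\<bar> \<le> 1"
    using assms by auto
  have c: "c + of_nat n \<noteq> 0" and c': "2 * c - 1 + of_nat n \<noteq> 0" for n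
  proof -
    have "\<mu> + 1/2 + real n \<noteq> 0" "2 * \<mu> + real n \<noteq> 0"
      using assms by (linarith, cases n) auto
    then have "complex_of_real (\<mu> + 1/2 + real n) \<noteq> 0" "complex_of_real (2 * \<mu> + real n) \<noteq> 0"
      by (simp_all only: of_real_eq_0_iff not_False_eq_True)
    then show "c + of_nat n \<noteq> 0" "2 * c - 1 + of_nat n \<noteq> 0"
      by (simp_all add: c_def)
  qed
  have "trm = (\<lambda>n. gegen_gf \<alpha> c (of_real x) $ n * of_real \<rho> ^ n)"
  proof
    fix n
    have "pochhammer (2 * complex_of_real \<mu>) n \<noteq> 0"
      using c' by (auto simp: pochhammer_eq_0_iff c_def eq_neg_iff_add_eq_0)
    then show "trm n = gegen_gf \<alpha> c (of_real x) $ n * of_real \<rho> ^ n"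
      using gegenbauer_eq_gegen_sum[OF assms(1) x]
      by (simp add: trm_def gegen_gf_def c_def)
  qed
  moreover have "gegen_dist x (of_real \<rho>) = of_real (R x)" "gegen_arg x (of_real \<rho>) = of_real (z x)"
    using gegen_dist_of_real(1,5)[OF x, of \<rho>] assms by (simp_all add: R_def z_def)
  ultimately have sums: "trm sums G x"
    using gegen_gf_sums[OF c c' x, of \<rho> \<alpha>] assms by (simp add: G_def F_def)
  have lhs: "lhs t = K * G t" if "t \<in> {-1<..<1}" for t
    using ferrers_P_eq_hyp_fps[of \<mu> \<rho> t \<alpha>] assms that
    by (simp add: lhs_def K_def G_def R_def F_def z_def c_def abs_less_iff)
  have R: "R t > 0" and z: "norm (complex_of_real (z t)) < 1" if "t \<in> {-1..1}" for t
  proof -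
    have t: "\<bar>t\<bar> \<le> 1" and \<rho>: "0 \<le> \<rho>"
      using that assms by auto
    show "R t > 0"
      using gegen_dist_of_real(2)[OF t \<rho> assms(4)] by (simp only: R_def)
    show "norm (complex_of_real (z t)) < 1"
      using gegen_dist_of_real(5,6)[OF t \<rho> assms(4)] by (simp only: R_def z_def)
  qed
  have contR: "continuous_on {-1..1} R"
    unfolding R_def by (intro continuous_intros)
  have contz: "continuous_on {-1..1} z"
    unfolding z_def by (intro continuous_intros contR) (use R in fastforce)+
  have contF: "continuous_on (ball 0 1) F"
    unfolding F_def
    by (rule continuous_on_subset[OF continuous_on_eval_fps]) (auto intro!: norm_less_conv_radius_hyp_fps c)
  have contG: "continuous_on {-1..1} G"
    unfolding G_def
  proof (intro continuous_on_mult continuous_on_powr_complex continuous_intros contR)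
    show "continuous_on {-1..1} (\<lambda>t. F (of_real (z t)))"
      by (rule continuous_on_compose2[OF contF]) (use z in \<open>auto intro!: continuous_intros contz\<close>)
  qed (use R in force)+
  have "(lhs \<longlongrightarrow> K * G x) (at x within {-1<..<1})"
  proof -
    have "(G \<longlongrightarrow> G x) (at x within {-1..1})"
      using contG assms by (simp add: continuous_on_def)
    then have "(G \<longlongrightarrow> G x) (at x within {-1<..<1})"
      by (rule tendsto_within_subset) auto
    then have "((\<lambda>t. K * G t) \<longlongrightarrow> K * G x) (at x within {-1<..<1})"
      by (rule tendsto_mult_left)
    moreover have "\<forall>\<^sub>F t in at x within {-1<..<1}. lhs t = K * G t"
      using lhs by (simp add: eventually_at_filter)
    ultimately show ?thesis
      by (simp add: tendsto_cong)
  qed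
  with sums lhs have "summable trm \<and> (x \<in> {-1<..<1} \<longrightarrow> lhs x = K * (\<Sum>n. trm n))
      \<and> (x \<in> {-1, 1} \<longrightarrow> (lhs \<longlongrightarrow> K * (\<Sum>n. trm n)) (at x within {-1<..<1}))"
    by (simp add: sums_iff)
  then show ?thesis
    unfolding Let_def lhs_def trm_def K_def R_def .
qed

end
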